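(* Fix an integer $m\ge2$ and let $Z$ be a fat point scheme in $\mathbb{P}^1\times\mathbb{P}^1$ all of whose points have multiplicity $m$. Then $Z$ is ACM if and only if $\mathrm{Supp}(Z)$ is a complete intersection.
   Context: $\mathbf{k}$ algebraically closed, $R=\mathbf{k}[x_0,x_1,y_0,y_1]$ bigraded with $\deg x_i=(1,0)$, $\deg y_i=(0,1)$; a point $[a_0:a_1]\times[b_0:b_1]$ has ideal $(a_1x_0-a_0x_1,b_1y_0-b_0y_1)$; a fat point scheme $Z=\{(P_1;m_1),\dots,(P_s;m_s)\}$ has ideal $I_Z=\bigcap\wp_{P_i}^{m_i}$ and is ACM if $R/I_Z$ is Cohen–Macaulay. A reduced set of points $\mathbb{X}$ is a complete intersection if its ideal is $I_{\mathbb{X}}=(F,G)$ with $F$ bihomogeneous of degree $(a,0)$ and $G$ bihomogeneous of degree $(0,b)$ for some $a,b$ (equivalently, $\mathbb{X}=\{R\times Q : R\in\pi_1(\mathbb{X}),\ Q\in\pi_2(\mathbb{X})\}$). *)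

theory Defs
  imports "HOL-Library.Poly_Mapping" "HOL-Library.Extended_Nat"
          "HOL-Computational_Algebra.Polynomial"
begin

datatype var = X0 | X1 | Y0 | Y1

text \<open>Polynomials in the four variables: finitely supported maps from monomials
  (finitely supported exponent vectors) to coefficients.\<close>
type_synonym 'k bpoly = "(var \<Rightarrow>\<^sub>0 nat) \<Rightarrow>\<^sub>0 'k"

definition Var :: "var \<Rightarrow> 'k::comm_ring_1 bpoly" where
  "Var v = Poly_Mapping.single (Poly_Mapping.single v 1) 1"

definition Const :: "'k::comm_ring_1 \<Rightarrow> 'k bpoly" where
  "Const c = Poly_Mapping.single 0 c"

definition bihomogeneous :: "nat \<Rightarrow> nat \<Rightarrow> 'k::comm_ring_1 bpoly \<Rightarrow> bool" where
  "bihomogeneous a b F \<longleftrightarrow>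
     (\<forall>\<mu>\<in>Poly_Mapping.keys F.
        Poly_Mapping.lookup \<mu> X0 + Poly_Mapping.lookup \<mu> X1 = a \<and> Poly_Mapping.lookup \<mu> Y0 + Poly_Mapping.lookup \<mu> Y1 = b)"

definition is_ideal :: "'a::comm_ring_1 set \<Rightarrow> bool" where
  "is_ideal I \<longleftrightarrow> 0 \<in> I \<and> (\<forall>a\<in>I. \<forall>b\<in>I. a + b \<in> I) \<and> (\<forall>r. \<forall>a\<in>I. r * a \<in> I)"

definition ideal_gen :: "'a::comm_ring_1 set \<Rightarrow> 'a set" where
  "ideal_gen S = \<Inter>{I. is_ideal I \<and> S \<subseteq> I}"

definition ideal_sum :: "'a::comm_ring_1 set \<Rightarrow> 'a set \<Rightarrow> 'a set" where
  "ideal_sum I J = ideal_gen (I \<union> J)"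

definition ideal_prod :: "'a::comm_ring_1 set \<Rightarrow> 'a set \<Rightarrow> 'a set" where
  "ideal_prod I J = ideal_gen {a * b | a b. a \<in> I \<and> b \<in> J}"

fun ideal_pow :: "'a::comm_ring_1 set \<Rightarrow> nat \<Rightarrow> 'a set" where
  "ideal_pow I 0 = UNIV"
| "ideal_pow I (Suc n) = ideal_prod I (ideal_pow I n)"

definition prime_ideal :: "'a::comm_ring_1 set \<Rightarrow> bool" where
  "prime_ideal P \<longleftrightarrow> is_ideal P \<and> P \<noteq> UNIV \<and> (\<forall>a b. a * b \<in> P \<longrightarrow> a \<in> P \<or> b \<in> P)"

definition krull_dim_quot :: "'a::comm_ring_1 set \<Rightarrow> enat" where
  "krull_dim_quot I = Sup {enat n | n. \<exists>P :: nat \<Rightarrow> 'a set.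
      (\<forall>i\<le>n. prime_ideal (P i) \<and> I \<subseteq> P i) \<and> (\<forall>i<n. P i \<subset> P (Suc i))}"

definition regular_seq :: "'a::comm_ring_1 set \<Rightarrow> 'a list \<Rightarrow> bool" where
  "regular_seq I fs \<longleftrightarrow>
     (\<forall>i<length fs. \<forall>g. fs ! i * g \<in> ideal_sum I (ideal_gen (set (take i fs)))
                        \<longrightarrow> g \<in> ideal_sum I (ideal_gen (set (take i fs))))
     \<and> ideal_sum I (ideal_gen (set fs)) \<noteq> UNIV"

definition irrelevant_ideal :: "'k::comm_ring_1 bpoly set" where
  "irrelevant_ideal = ideal_gen (range Var)"

definition depth_quot :: "'k::comm_ring_1 bpoly set \<Rightarrow> enat" where
  "depth_quot I = Sup {enat (length fs) | fs. set fs \<subseteq> irrelevant_ideal \<and> regular_seq I fs}"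

text \<open>For the (homogeneous) ideal I, R/I is Cohen--Macaulay iff depth = dimension.\<close>
definition ACM_ideal :: "'k::comm_ring_1 bpoly set \<Rightarrow> bool" where
  "ACM_ideal I \<longleftrightarrow> depth_quot I = krull_dim_quot I"

text \<open>A point [a0:a1] x [b0:b1] is represented by ((a0,a1),(b0,b1)).\<close>
type_synonym 'k point = "('k \<times> 'k) \<times> ('k \<times> 'k)"

definition valid_point :: "'k::field point \<Rightarrow> bool" where
  "valid_point P \<longleftrightarrow> fst P \<noteq> (0, 0) \<and> snd P \<noteq> (0, 0)"

definition point_ideal :: "'k::field point \<Rightarrow> 'k bpoly set" where
  "point_ideal P = (case P of ((a0, a1), (b0, b1)) \<Rightarrow>
     ideal_gen {Const a1 * Var X0 - Const a0 * Var X1, Const b1 * Var Y0 - Const b0 * Var Y1})"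

definition fat_ideal :: "nat \<Rightarrow> 'k::field point set \<Rightarrow> 'k bpoly set" where
  "fat_ideal m S = (\<Inter>P\<in>S. ideal_pow (point_ideal P) m)"

definition points_ideal :: "'k::field point set \<Rightarrow> 'k bpoly set" where
  "points_ideal S = (\<Inter>P\<in>S. point_ideal P)"

definition complete_intersection :: "'k::field point set \<Rightarrow> bool" where
  "complete_intersection S \<longleftrightarrow>
     (\<exists>a b F G. bihomogeneous a 0 F \<and> bihomogeneous 0 b G \<and> points_ideal S = ideal_gen {F, G})"

end

theory Submission
  imports Defs
begin

text \<open>All quotients have dimension 2, so the question is whether the depth is 2. Over a grid \<open>A \<times> B\<close>
  the fat ideal is \<open>(F, G)\<^sup>m\<close>, with \<open>F\<close> and \<open>G\<close> the products of the linear forms of the columns and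
  rows, and a general linear form in \<open>x\<close> followed by one in \<open>y\<close> is a regular sequence. Off a grid,
  let \<open>l\<close> be a general linear form in \<open>x\<close>, call a row full if it meets all columns, and let \<open>w\<close> be the
  number of columns whose points all lie in full rows. Every form of the ideal whose \<open>y\<close>-degree is the
  number of full rows has \<open>x\<close>-degree at least \<open>m |A| - w\<close>, whereas locally at each row of the
  support the degree \<open>m |A| - w - 1\<close> already suffices modulo \<open>l\<close>, because \<open>m \<ge> 2\<close>. The discrepancy is
  a socle element modulo \<open>l\<close>, and the depth is at most 1. The depth is compared between different
  regular sequences by exchanging one element at a time.\<close>

section \<open>Ideals and regular elements\<close>

text \<open>Depth is a supremum over all regular sequences in the irrelevant ideal, homogeneous or
  not, so exhibiting one sequence bounds nothing from above. The invariant carried along is the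
  socle: a nonzero class modulo the sequence killed by the irrelevant ideal, which forbids any
  further regular element. Comparing sequences of length two needs an element regular modulo both
  first entries; McCoy's theorem supplies one after adjoining an indeterminate. The number
  \<open>m |A| - w\<close> arises by dividing once by the full rows: a column loses one order of
  vanishing exactly when all its points lie on full rows. The bound \<open>m >= 2\<close> separates
  fat from reduced points: for m = 1, three corners of a square are ACM without being a grid, and
  the degree \<open>m |A| - w - 1 = 0\<close> does not suffice at their row that is not
  full.\<close>

lemma is_idealD:
  assumes "is_ideal I"
  shows ideal_zero: "0 \<in> I"
    and ideal_add: "a \<in> I \<Longrightarrow> b \<in> I \<Longrightarrow> a + b \<in> I"
    and ideal_mult: "a \<in> I \<Longrightarrow> r * a \<in> I"
    and ideal_mult_right: "a \<in> I \<Longrightarrow> a * r \<in> I"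
  using assms by (auto simp: is_ideal_def mult.commute[of a r])

lemma ideal_uminus: "is_ideal I \<Longrightarrow> a \<in> I \<Longrightarrow> - a \<in> I"
  using ideal_mult[of I a "-1"] by simp

lemma ideal_diff: "is_ideal I \<Longrightarrow> a \<in> I \<Longrightarrow> b \<in> I \<Longrightarrow> a - b \<in> I"
  using ideal_add[of I a "-b"] ideal_uminus[of I b] by simp

lemma ideal_diff_iff: "is_ideal I \<Longrightarrow> a - b \<in> I \<Longrightarrow> a \<in> I \<longleftrightarrow> b \<in> I"
  using ideal_add[of I "a - b" b] ideal_diff[of I a "a - b"] by auto

lemma ideal_eq_UNIV: "is_ideal I \<Longrightarrow> 1 \<in> I \<Longrightarrow> I = UNIV"
  using ideal_mult[of I 1] by auto

lemma is_ideal_zero: "is_ideal {0}"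
  and is_ideal_UNIV: "is_ideal UNIV"
  by (auto simp: is_ideal_def)

lemma is_ideal_INT: "(\<And>i. i \<in> A \<Longrightarrow> is_ideal (I i)) \<Longrightarrow> is_ideal (\<Inter>i\<in>A. I i)"
  by (auto simp: is_ideal_def)

lemma is_ideal_ideal_gen: "is_ideal (ideal_gen S)"
  by (auto simp: ideal_gen_def is_ideal_def)

lemma ideal_gen_superset: "S \<subseteq> ideal_gen S"
  by (auto simp: ideal_gen_def)

lemma ideal_gen_least: "is_ideal I \<Longrightarrow> S \<subseteq> I \<Longrightarrow> ideal_gen S \<subseteq> I"
  by (auto simp: ideal_gen_def)

lemma ideal_gen_eqI: "S \<subseteq> ideal_gen T \<Longrightarrow> T \<subseteq> ideal_gen S \<Longrightarrow> ideal_gen S = ideal_gen T"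
  by (meson ideal_gen_least is_ideal_ideal_gen subset_antisym)

lemma ideal_gen_empty: "ideal_gen {} = {0}"
  using ideal_gen_least[OF is_ideal_zero, of "{}"] ideal_zero[OF is_ideal_ideal_gen] by auto

section \<open>Adjoining an element, regular elements and socles\<close>

definition adjoin :: "'a::comm_ring_1 set \<Rightarrow> 'a \<Rightarrow> 'a set" where
  "adjoin J f = {j + f * r | j r. j \<in> J}"

text \<open>Properness of the quotient is left out, so products, powers and intersections carry no
  side conditions.\<close>

definition nzd :: "'a::comm_ring_1 set \<Rightarrow> 'a \<Rightarrow> bool" where
  "nzd J f \<longleftrightarrow> (\<forall>g. f * g \<in> J \<longrightarrow> g \<in> J)"

definition has_socle :: "'a::comm_ring_1 set \<Rightarrow> 'a set \<Rightarrow> bool" where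
  "has_socle M J \<longleftrightarrow> (\<exists>z. z \<notin> J \<and> (\<forall>a\<in>M. a * z \<in> J))"

lemma adjoinI: "j \<in> J \<Longrightarrow> j + f * r \<in> adjoin J f"
  by (auto simp: adjoin_def)

lemma adjoinE: assumes "x \<in> adjoin J f" obtains j r where "j \<in> J" "x = j + f * r"
  using assms by (auto simp: adjoin_def)

lemma adjoin_iff: "is_ideal J \<Longrightarrow> x \<in> adjoin J f \<longleftrightarrow> (\<exists>r. x - f * r \<in> J)"
proof
  assume "\<exists>r. x - f * r \<in> J"
  then obtain r where "x - f * r \<in> J" ..
  then show "x \<in> adjoin J f" using adjoinI[of "x - f * r" J f r] by simp
next
  assume "x \<in> adjoin J f"
  then obtain j r where "j \<in> J" "x = j + f * r" by (rule adjoinE)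
  then have "x - f * r \<in> J" by simp
  then show "\<exists>r. x - f * r \<in> J" ..
qed

lemma adjoin_superset: "J \<subseteq> adjoin J f"
  using adjoinI[of _ J f 0] by auto

lemma adjoin_mem: "is_ideal J \<Longrightarrow> f * r \<in> adjoin J f"
  using adjoinI[of 0 J f r] by (auto simp: is_ideal_def)

lemma adjoin_self: "is_ideal J \<Longrightarrow> f \<in> adjoin J f"
  using adjoin_mem[of J f 1] by simp

lemma is_ideal_adjoin:
  assumes J: "is_ideal J" shows "is_ideal (adjoin J f)"
  unfolding is_ideal_def
proof (intro conjI ballI allI)
  show "0 \<in> adjoin J f" using adjoin_superset ideal_zero[OF J] by blast
next
  fix a b assume "a \<in> adjoin J f" "b \<in> adjoin J f"
  then obtain j r k s where "j \<in> J" "k \<in> J" "a = j + f * r" "b = k + f * s"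
    by (auto elim!: adjoinE)
  then show "a + b \<in> adjoin J f"
    using adjoinI[of "j + k" J f "r + s"] ideal_add[OF J] by (simp add: algebra_simps)
next
  fix r a assume "a \<in> adjoin J f"
  then obtain j s where "j \<in> J" "a = j + f * s" by (auto elim!: adjoinE)
  then show "r * a \<in> adjoin J f"
    using adjoinI[of "r * j" J f "r * s"] ideal_mult[OF J] by (simp add: algebra_simps)
qed

lemma adjoin_least: "is_ideal I \<Longrightarrow> J \<subseteq> I \<Longrightarrow> f \<in> I \<Longrightarrow> adjoin J f \<subseteq> I"
  by (auto elim!: adjoinE intro!: ideal_add ideal_mult_right)

lemma adjoin_mono: "J \<subseteq> J' \<Longrightarrow> adjoin J f \<subseteq> adjoin J' f"
  by (auto simp: adjoin_def)

lemma adjoin_commute: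
  assumes "is_ideal J" shows "adjoin (adjoin J f) g = adjoin (adjoin J g) f"
proof -
  have "adjoin (adjoin J f) g \<subseteq> adjoin (adjoin J g) f" for f g
    using assms
    by (meson adjoin_least adjoin_mono adjoin_self adjoin_superset is_ideal_adjoin subsetD)
  then show ?thesis by blast
qed

lemma ideal_gen_insert: "ideal_gen (insert f S) = adjoin (ideal_gen S) f"
proof (rule subset_antisym)
  show "ideal_gen (insert f S) \<subseteq> adjoin (ideal_gen S) f"
    using adjoin_self[OF is_ideal_ideal_gen] adjoin_superset ideal_gen_superset
    by (intro ideal_gen_least is_ideal_adjoin is_ideal_ideal_gen) blast
  show "adjoin (ideal_gen S) f \<subseteq> ideal_gen (insert f S)"
    using ideal_gen_superset[of "insert f S"]
    by (intro adjoin_least is_ideal_ideal_gen ideal_gen_least) auto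
qed

lemma ideal_gen_singleton: "ideal_gen {f} = adjoin {0} f"
  by (simp add: ideal_gen_insert ideal_gen_empty)

lemma ideal_gen_pair: "ideal_gen {f, g} = adjoin (adjoin {0} g) f"
  by (simp add: ideal_gen_insert ideal_gen_empty)

lemma ideal_gen_ideal: "is_ideal J \<Longrightarrow> ideal_gen J = J"
  using ideal_gen_least[of J J] ideal_gen_superset[of J] by auto

lemma ideal_sum_ideal_gen: "ideal_sum I (ideal_gen S) = ideal_gen (I \<union> S)"
  unfolding ideal_sum_def
proof (rule ideal_gen_eqI)
  have "S \<subseteq> ideal_gen (I \<union> S)" using ideal_gen_superset by blast
  then have "ideal_gen S \<subseteq> ideal_gen (I \<union> S)" by (rule ideal_gen_least[OF is_ideal_ideal_gen])
  then show "I \<union> ideal_gen S \<subseteq> ideal_gen (I \<union> S)" using ideal_gen_superset by blast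
  show "I \<union> S \<subseteq> ideal_gen (I \<union> ideal_gen S)"
    using ideal_gen_superset[of S] ideal_gen_superset[of "I \<union> ideal_gen S"] by blast
qed

lemma ideal_sum_empty: "is_ideal I \<Longrightarrow> ideal_sum I (ideal_gen {}) = I"
  by (simp add: ideal_sum_ideal_gen ideal_gen_ideal)

lemma ideal_sum_insert: "ideal_sum I (ideal_gen (insert f S)) = adjoin (ideal_sum I (ideal_gen S)) f"
  unfolding ideal_sum_ideal_gen by (simp add: ideal_gen_insert)

lemma nzdD: "nzd J f \<Longrightarrow> f * g \<in> J \<Longrightarrow> g \<in> J"
  by (simp add: nzd_def)

lemma nzd_one: "nzd J 1"
  by (simp add: nzd_def)

lemma nzd_mult: "nzd J f \<Longrightarrow> nzd J g \<Longrightarrow> nzd J (f * g)"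
  unfolding nzd_def mult.assoc by blast

lemma nzd_power: "nzd J f \<Longrightarrow> nzd J (f ^ n)"
  by (induction n) (auto intro: nzd_mult nzd_one)

lemma nzd_prod: "(\<And>i. i \<in> A \<Longrightarrow> nzd J (f i)) \<Longrightarrow> nzd J (\<Prod>i\<in>A. f i)"
  by (induction A rule: infinite_finite_induct) (auto intro: nzd_mult nzd_one)

lemma nzd_INT: "(\<And>i. i \<in> A \<Longrightarrow> nzd (J i) f) \<Longrightarrow> nzd (\<Inter>i\<in>A. J i) f"
  by (auto simp: nzd_def)

lemma nzd_prime: "prime_ideal P \<Longrightarrow> f \<notin> P \<Longrightarrow> nzd P f"
  by (auto simp: nzd_def prime_ideal_def)

lemma prime_ideal_is_ideal: "prime_ideal P \<Longrightarrow> is_ideal P"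
  by (simp add: prime_ideal_def)

lemma prime_ideal_prod:
  assumes "prime_ideal P" "finite A" "(\<Prod>i\<in>A. f i) \<in> P"
  shows "\<exists>i\<in>A. f i \<in> P"
  using assms(2,3)
proof (induction A rule: finite_induct)
  case empty
  then have "1 \<in> P" by simp
  then show ?case using assms(1) ideal_eq_UNIV by (auto simp: prime_ideal_def)
next
  case (insert x A) then show ?case using assms(1) by (auto simp: prime_ideal_def)
qed

lemma prime_ideal_power: "prime_ideal P \<Longrightarrow> f ^ n \<in> P \<Longrightarrow> f \<in> P"
  using prime_ideal_prod[of P "{..<n}" "\<lambda>_. f"] by auto

lemma ideal_prod_mem:
  assumes "is_ideal I" "finite A" "i \<in> A" "f i \<in> I"
  shows "(\<Prod>i\<in>A. f i) \<in> I"
  using assms by (auto simp: prod.remove intro: ideal_mult_right)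

text \<open>From \<open>f a = g b\<close> modulo \<open>J\<close>, regularity of \<open>g\<close>
  modulo \<open>f\<close> makes \<open>b\<close> a multiple of \<open>f\<close>, and
  \<open>f\<close> cancels. This is the half of the permutability of regular sequences that holds in
  every commutative ring.\<close>

lemma nzd_adjoin_swap:
  assumes J: "is_ideal J" and f: "nzd J f" and g: "nzd (adjoin J f) g"
  shows "nzd (adjoin J g) f"
  unfolding nzd_def
proof (intro allI impI)
  fix a assume "f * a \<in> adjoin J g"
  then obtain j b where j: "j \<in> J" "f * a = j + g * b" by (rule adjoinE)
  then have "g * b = - j + f * a" by simp
  then have "g * b \<in> adjoin J f" using j ideal_uminus[OF J] by (metis adjoinI)
  then have "b \<in> adjoin J f" by (rule nzdD[OF g])
  then obtain j' c where c: "j' \<in> J" "b = j' + f * c" by (rule adjoinE)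
  have "f * (a - g * c) = j + g * j'" using j c by (simp add: algebra_simps)
  then have "a - g * c \<in> J"
    using nzdD[OF f] j c by (metis J ideal_add ideal_mult)
  then show "a \<in> adjoin J g" using adjoin_iff[OF J] by blast
qed

lemma nzd_adjoin_power:
  assumes J: "is_ideal J" and v: "nzd J v" and w: "nzd (adjoin J v) w"
  shows "nzd (adjoin J (v ^ n)) w"
proof (induction n)
  case 0
  then show ?case using adjoin_mem[OF J, of 1] by (simp add: nzd_def)
next
  case (Suc n)
  show ?case unfolding nzd_def
  proof (intro allI impI)
    fix f assume "w * f \<in> adjoin J (v ^ Suc n)"
    then obtain j h where h: "j \<in> J" "w * f = j + v ^ Suc n * h" by (rule adjoinE)
    then have "w * f = j + v * (v ^ n * h)" by (simp add: mult.assoc)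
    then have "w * f \<in> adjoin J v" using adjoinI h(1) by metis
    then have "f \<in> adjoin J v" by (rule nzdD[OF w])
    then obtain j' f' where f': "j' \<in> J" "f = j' + v * f'" by (rule adjoinE)
    have "v * (w * f' - v ^ n * h) = j - w * j'" using h f' by (simp add: algebra_simps)
    then have "v * (w * f' - v ^ n * h) \<in> J" using h f' ideal_diff[OF J] ideal_mult[OF J] by metis
    then have "w * f' - v ^ n * h \<in> J" by (rule nzdD[OF v])
    then have "w * f' \<in> adjoin J (v ^ n)" using adjoin_iff[OF J] by blast
    then have "f' \<in> adjoin J (v ^ n)" by (rule nzdD[OF Suc])
    then obtain j'' r where r: "j'' \<in> J" "f' = j'' + v ^ n * r" by (rule adjoinE)
    have "f = (j' + v * j'') + v ^ Suc n * r" using f' r by (simp add: algebra_simps)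
    then show "f \<in> adjoin J (v ^ Suc n)"
      using f'(1) r(1) J by (metis adjoinI ideal_add ideal_mult)
  qed
qed

text \<open>The product obtained so far is regular modulo the next power, so the cofactor must
  absorb that power.\<close>

lemma adjoin_prod_power:
  assumes J: "is_ideal J" and "finite A"
    and v: "\<And>r. r \<in> A \<Longrightarrow> nzd J (v r)"
    and vv: "\<And>r s. r \<in> A \<Longrightarrow> s \<in> A \<Longrightarrow> r \<noteq> s \<Longrightarrow> nzd (adjoin J (v s)) (v r)"
    and f: "\<And>r. r \<in> A \<Longrightarrow> f \<in> adjoin J (v r ^ e r)"
  shows "f \<in> adjoin J (\<Prod>r\<in>A. v r ^ e r)"
  using \<open>finite A\<close> v vv f
proof (induction A rule: finite_induct)
  case empty
  then show ?case using adjoin_mem[OF J, of 1] by simp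
next
  case (insert s A)
  let ?V = "\<Prod>r\<in>A. v r ^ e r"
  have "f \<in> adjoin J ?V" using insert by auto
  then obtain j y where y: "j \<in> J" "f = j + ?V * y" by (rule adjoinE)
  have "f - j \<in> adjoin J (v s ^ e s)"
    using insert.prems(3)[of s] y(1) adjoin_superset[of J]
    by (intro ideal_diff is_ideal_adjoin J) auto
  then have "?V * y \<in> adjoin J (v s ^ e s)" using y by simp
  moreover have "nzd (adjoin J (v s ^ e s)) ?V"
  proof (intro nzd_prod nzd_power nzd_adjoin_power J)
    fix r assume "r \<in> A"
    then show "nzd (adjoin J (v s)) (v r)" using insert.prems(2)[of r s] insert.hyps by auto
  qed (use insert in auto)
  ultimately have "y \<in> adjoin J (v s ^ e s)" by (rule nzdD[rotated])
  then obtain j' h where h: "j' \<in> J" "y = j' + v s ^ e s * h" by (rule adjoinE)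
  have "f = (j + ?V * j') + (v s ^ e s * ?V) * h" using y h by (simp add: algebra_simps)
  moreover have "j + ?V * j' \<in> J" using y h J by (simp add: ideal_add ideal_mult)
  ultimately have "f \<in> adjoin J (v s ^ e s * ?V)" using adjoinI by metis
  then show ?case using insert.hyps by simp
qed

text \<open>Multiplying by \<open>f\<close> and dividing by \<open>g\<close> sends \<open>z\<close>
  to \<open>w\<close>. For \<open>f\<close> and \<open>g\<close> in an ideal \<open>M\<close> this
  is the identification of both socles with Ext^1(R/M, R/J), followed on a single element.\<close>

lemma has_socle_exchange:
  assumes J: "is_ideal J" and f: "nzd J f" and g: "nzd J g" and M: "f \<in> M"
    and soc: "has_socle M (adjoin J g)"
  shows "has_socle M (adjoin J f)"
proof -
  obtain z where z: "z \<notin> adjoin J g" "\<And>a. a \<in> M \<Longrightarrow> a * z \<in> adjoin J g"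
    using soc by (auto simp: has_socle_def)
  obtain w where w: "f * z - g * w \<in> J" using z(2)[OF M] adjoin_iff[OF J] by blast
  have "w \<notin> adjoin J f"
  proof
    assume "w \<in> adjoin J f"
    then obtain c where "w - f * c \<in> J" using adjoin_iff[OF J] by blast
    then have "(f * z - g * w) + g * (w - f * c) \<in> J" using w J by (simp add: ideal_add ideal_mult)
    then have "f * (z - g * c) \<in> J" by (simp add: algebra_simps)
    then have "z - g * c \<in> J" by (rule nzdD[OF f])
    then show False using z(1) adjoin_iff[OF J] by blast
  qed
  moreover have "a * w \<in> adjoin J f" if a: "a \<in> M" for a
  proof -
    obtain b where b: "a * z - g * b \<in> J" using z(2)[OF a] adjoin_iff[OF J] by blast
    have "f * (a * z - g * b) - a * (f * z - g * w) \<in> J"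
      using w b J by (simp add: ideal_diff ideal_mult)
    then have "g * (a * w - f * b) \<in> J" by (simp add: algebra_simps)
    then have "a * w - f * b \<in> J" by (rule nzdD[OF g])
    then show ?thesis using adjoin_iff[OF J] by blast
  qed
  ultimately show ?thesis by (auto simp: has_socle_def)
qed

lemma nzd_not_has_socle: "nzd J f \<Longrightarrow> f \<in> M \<Longrightarrow> \<not> has_socle M J"
  by (auto simp: nzd_def has_socle_def)

text \<open>Apply the factors to \<open>z\<close> one by one: the last product outside
  \<open>J\<close> is killed by the next factor. Socle elements are found in this way, one linear
  form at a time.\<close>

lemma killed_by_prod_factor:
  assumes J: "is_ideal J" and "finite A" "(\<Prod>i\<in>A. k i ^ e i) * z \<in> J" "z \<notin> J"
  shows "\<exists>i\<in>A. \<exists>r. r * z \<notin> J \<and> k i * (r * z) \<in> J"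
  using assms(2-4)
proof (induction A arbitrary: z rule: finite_induct)
  case empty then show ?case by simp
next
  case (insert s A)
  show ?case
  proof (cases "k s ^ e s * z \<in> J")
    case True
    define n where "n = (LEAST n. k s ^ n * z \<in> J)"
    have n: "k s ^ n * z \<in> J" unfolding n_def using True by (rule LeastI)
    obtain n' where n': "n = Suc n'" using n insert.prems by (cases n) auto
    have "k s ^ n' * z \<notin> J" using not_less_Least[of n' "\<lambda>n. k s ^ n * z \<in> J"] n' n_def by auto
    moreover have "k s * (k s ^ n' * z) \<in> J" using n n' by (simp add: mult.assoc)
    ultimately show ?thesis by blast
  next
    case False
    have "(\<Prod>i\<in>A. k i ^ e i) * (k s ^ e s * z) \<in> J" using insert by (simp add: algebra_simps)
    from insert.IH[OF this False] obtain i r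
      where "i \<in> A" "r * (k s ^ e s * z) \<notin> J" "k i * (r * (k s ^ e s * z)) \<in> J" by blast
    then show ?thesis by (intro bexI[of _ i] exI[of _ "r * k s ^ e s"]) (auto simp: mult.assoc)
  qed
qed

section \<open>Powers of two-generated ideals\<close>

text \<open>This is \<open>(u, v)\<^sup>n + J\<close>.\<close>
fun pair_pow :: "'a::comm_ring_1 set \<Rightarrow> 'a \<Rightarrow> 'a \<Rightarrow> nat \<Rightarrow> 'a set" where
  "pair_pow J u v 0 = UNIV"
| "pair_pow J u v (Suc n) = {j + u * f + v ^ Suc n * h | j f h. j \<in> J \<and> f \<in> pair_pow J u v n}"

lemma pair_powI: "j \<in> J \<Longrightarrow> f \<in> pair_pow J u v n \<Longrightarrow> j + u * f + v ^ Suc n * h \<in> pair_pow J u v (Suc n)"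
  by auto

lemma pair_powE:
  assumes "x \<in> pair_pow J u v (Suc n)"
  obtains j f h where "j \<in> J" "f \<in> pair_pow J u v n" "x = j + u * f + v ^ Suc n * h"
  using assms by auto

lemma is_ideal_pair_pow:
  assumes J: "is_ideal J" shows "is_ideal (pair_pow J u v n)"
proof (induction n)
  case 0 then show ?case by (simp add: is_ideal_UNIV)
next
  case (Suc n)
  show ?case unfolding is_ideal_def
  proof (intro conjI ballI allI)
    show "0 \<in> pair_pow J u v (Suc n)"
      using pair_powI[of 0 J 0 u v n 0] ideal_zero[OF J] ideal_zero[OF Suc] by simp
  next
    fix a b assume "a \<in> pair_pow J u v (Suc n)" "b \<in> pair_pow J u v (Suc n)"
    then obtain j f h j' f' h' where "j \<in> J" "f \<in> pair_pow J u v n" "a = j + u * f + v ^ Suc n * h"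
      "j' \<in> J" "f' \<in> pair_pow J u v n" "b = j' + u * f' + v ^ Suc n * h'" by (metis pair_powE)
    then show "a + b \<in> pair_pow J u v (Suc n)"
      using pair_powI[of "j + j'" J "f + f'" u v n "h + h'"] ideal_add[OF J] ideal_add[OF Suc]
      by (simp add: algebra_simps)
  next
    fix r a assume "a \<in> pair_pow J u v (Suc n)"
    then obtain j f h where "j \<in> J" "f \<in> pair_pow J u v n" "a = j + u * f + v ^ Suc n * h"
      by (rule pair_powE)
    then show "r * a \<in> pair_pow J u v (Suc n)"
      using pair_powI[of "r * j" J "r * f" u v n "r * h"] ideal_mult[OF J] ideal_mult[OF Suc]
      by (simp add: algebra_simps)
  qed
qed

lemma pair_pow_base: "is_ideal J \<Longrightarrow> J \<subseteq> pair_pow J u v n"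
proof (cases n)
  case (Suc k)
  assume J: "is_ideal J"
  show ?thesis
    using pair_powI[of _ J 0 u v k 0] ideal_zero[OF is_ideal_pair_pow[OF J]] Suc by auto
qed simp

lemma pair_pow_right: "is_ideal J \<Longrightarrow> v ^ n * h \<in> pair_pow J u v n"
proof (cases n)
  case (Suc k)
  assume J: "is_ideal J"
  show ?thesis
    using pair_powI[of 0 J 0 u v k h] ideal_zero[OF J] ideal_zero[OF is_ideal_pair_pow[OF J]] Suc by simp
qed simp

lemma pair_pow_left: "is_ideal J \<Longrightarrow> f \<in> pair_pow J u v n \<Longrightarrow> u * f \<in> pair_pow J u v (Suc n)"
  using pair_powI[of 0 J f u v n 0] ideal_zero[of J] by simp

lemma pair_pow_subset: "is_ideal J \<Longrightarrow> pair_pow J u v n \<subseteq> adjoin (adjoin J u) (v ^ n)"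
proof (cases n)
  case 0
  assume "is_ideal J"
  then show ?thesis using 0 adjoin_mem[OF is_ideal_adjoin, of J 1] by auto
next
  case (Suc k)
  then show ?thesis by (auto simp del: power_Suc intro!: adjoinI)
qed

lemma pair_pow_right_mult:
  assumes J: "is_ideal J"
  shows "f \<in> pair_pow J u v n \<Longrightarrow> v * f \<in> pair_pow J u v (Suc n)"
proof (induction n arbitrary: f)
  case 0
  then show ?case using pair_pow_right[OF J, of v 1 f u] by simp
next
  case (Suc n)
  then obtain j g h where *: "j \<in> J" "g \<in> pair_pow J u v n" "f = j + u * g + v ^ Suc n * h"
    by (metis pair_powE)
  have "v * f = v * j + u * (v * g) + v ^ Suc (Suc n) * h" using * by (simp add: algebra_simps)
  then show ?case using Suc.IH[OF *(2)] *(1) J by (metis ideal_mult pair_powI)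
qed

text \<open>The recursion of \<open>pair_pow\<close> is lopsided in \<open>u\<close> and
  \<open>v\<close>; the link to an unordered generating set yields
  \<open>pair_pow_commute\<close>.\<close>

lemma ideal_pow_pair: "ideal_pow (ideal_gen {u, v}) n = pair_pow {0} u v n"
proof (induction n)
  case (Suc n)
  note id = is_ideal_pair_pow[OF is_ideal_zero]
  have gen: "ideal_gen {u, v} = {a * u + b * v | a b. True}"
    unfolding ideal_gen_pair by (auto simp: adjoin_def) (metis add.commute mult.commute)+
  have "{a * b | a b. a \<in> ideal_gen {u, v} \<and> b \<in> pair_pow {0} u v n} \<subseteq> pair_pow {0} u v (Suc n)"
  proof (clarify)
    fix a b assume "a \<in> ideal_gen {u, v}" and b: "b \<in> pair_pow {0} u v n"
    then obtain c d where "a = c * u + d * v" unfolding gen by auto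
    then have "a * b = c * (u * b) + d * (v * b)" by (simp add: algebra_simps)
    then show "a * b \<in> pair_pow {0} u v (Suc n)"
      using pair_pow_left[OF is_ideal_zero b] pair_pow_right_mult[OF is_ideal_zero b] id
      by (metis ideal_add ideal_mult)
  qed
  then have 1: "ideal_pow (ideal_gen {u, v}) (Suc n) \<subseteq> pair_pow {0} u v (Suc n)"
    unfolding ideal_pow.simps ideal_prod_def Suc by (rule ideal_gen_least[OF id])
  have 2: "a * b \<in> ideal_pow (ideal_gen {u, v}) (Suc n)"
    if "a \<in> ideal_gen {u, v}" "b \<in> pair_pow {0} u v n" for a b
    unfolding ideal_pow.simps ideal_prod_def Suc using that by (intro subsetD[OF ideal_gen_superset]) auto
  have uv: "u \<in> ideal_gen {u, v}" "v \<in> ideal_gen {u, v}" using ideal_gen_superset by blast+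
  have "pair_pow {0} u v (Suc n) \<subseteq> ideal_pow (ideal_gen {u, v}) (Suc n)"
  proof
    fix x assume "x \<in> pair_pow {0} u v (Suc n)"
    then obtain f h where fh: "f \<in> pair_pow {0} u v n" "x = u * f + v * (v ^ n * h)"
      by (auto elim!: pair_powE simp: mult.assoc)
    have "is_ideal (ideal_pow (ideal_gen {u, v}) (Suc n))"
      by (simp add: ideal_prod_def is_ideal_ideal_gen)
    moreover have "v ^ n * h \<in> pair_pow {0} u v n" by (rule pair_pow_right[OF is_ideal_zero])
    ultimately show "x \<in> ideal_pow (ideal_gen {u, v}) (Suc n)"
      using fh 2[OF uv(1)] 2[OF uv(2)] ideal_add by blast
  qed
  with 1 show ?case by blast
qed simp

lemma adjoin_pair_pow: "is_ideal J \<Longrightarrow> adjoin (pair_pow J u v n) l = pair_pow (adjoin J l) u v n"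
proof (induction n)
  case 0
  then show ?case using adjoin_superset[of UNIV l] by auto
next
  case (Suc n)
  note J = Suc.prems
  show ?case
  proof (rule set_eqI, rule iffI)
    fix x assume "x \<in> adjoin (pair_pow J u v (Suc n)) l"
    then obtain j f h r where *: "j \<in> J" "f \<in> pair_pow J u v n" "x = j + u * f + v ^ Suc n * h + l * r"
      by (metis adjoinE pair_powE)
    have "f \<in> pair_pow (adjoin J l) u v n" using Suc *(2) adjoin_superset by blast
    moreover have "x = (j + l * r) + u * f + v ^ Suc n * h" using * by (simp add: algebra_simps)
    ultimately show "x \<in> pair_pow (adjoin J l) u v (Suc n)"
      using *(1) by (metis adjoinI pair_powI)
  next
    fix x assume "x \<in> pair_pow (adjoin J l) u v (Suc n)"
    then obtain j r f h where *: "j \<in> J" "f \<in> pair_pow (adjoin J l) u v n"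
        "x = j + l * r + u * f + v ^ Suc n * h"
      by (metis adjoinE pair_powE)
    then obtain g s where g: "g \<in> pair_pow J u v n" "f = g + l * s"
      using Suc by (metis adjoinE)
    have "x = (j + u * g + v ^ Suc n * h) + l * (r + u * s)" using * g by (simp add: algebra_simps)
    then show "x \<in> adjoin (pair_pow J u v (Suc n)) l"
      using pair_powI[OF *(1) g(1)] by (metis adjoinI)
  qed
qed

text \<open>If \<open>u f = u g + v^(n+1) h\<close> modulo \<open>J\<close>, then \<open>u\<close>
  divides \<open>h\<close> modulo \<open>J\<close>, because \<open>v\<close> is regular modulo
  \<open>u\<close>. After \<open>u\<close> is cancelled, all remaining terms lie in the n-th
  power.\<close>

lemma pair_pow_cancel:
  assumes J: "is_ideal J" and u: "nzd J u" and v: "nzd (adjoin J u) v"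
    and f: "u * f \<in> pair_pow J u v (Suc n)"
  shows "f \<in> pair_pow J u v n"
proof -
  note id = is_ideal_pair_pow[OF J, of u v n]
  obtain j g h where *: "j \<in> J" "g \<in> pair_pow J u v n" "u * f = j + u * g + v ^ Suc n * h"
    using f by (rule pair_powE)
  have "v ^ Suc n * h = - j + u * (f - g)" using * by (simp add: algebra_simps)
  then have "v ^ Suc n * h \<in> adjoin J u" using *(1) J by (metis adjoinI ideal_uminus)
  then have "h \<in> adjoin J u" by (rule nzdD[OF nzd_power[OF v]])
  then obtain j' h' where h: "j' \<in> J" "h = j' + u * h'" by (rule adjoinE)
  have "u * (f - g - v ^ Suc n * h') = j + v ^ Suc n * j'"
    using * h by (simp add: algebra_simps)
  then have "u * (f - g - v ^ Suc n * h') \<in> J" using *(1) h(1) J by (metis ideal_add ideal_mult)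
  then have "f - g - v ^ Suc n * h' \<in> J" by (rule nzdD[OF u])
  then have "f - g - v ^ Suc n * h' \<in> pair_pow J u v n" using pair_pow_base[OF J] by blast
  moreover have "v ^ n * (v * h') \<in> pair_pow J u v n" by (rule pair_pow_right[OF J])
  then have "v ^ Suc n * h' \<in> pair_pow J u v n" by (simp add: ac_simps)
  ultimately have "(f - g - v ^ Suc n * h') + (g + v ^ Suc n * h') \<in> pair_pow J u v n"
    using *(2) id by (intro ideal_add)
  then show ?thesis by simp
qed

text \<open>Powers of an ideal generated by a regular sequence acquire no new zero divisors. Modulo
  \<open>u\<close> only \<open>v^(n+1)\<close> remains, which \<open>nzd_adjoin_power\<close>
  handles; the rest is \<open>u * f1\<close>, and cancelling \<open>u\<close> lowers the
  power.\<close>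

lemma nzd_pair_pow:
  assumes J: "is_ideal J" and u: "nzd J u" and v: "nzd (adjoin J u) v"
    and w: "nzd (adjoin (adjoin J u) v) w"
  shows "nzd (pair_pow J u v n) w"
proof (induction n)
  case (Suc n)
  note id = is_ideal_pair_pow[OF J]
  show ?case unfolding nzd_def
  proof (intro allI impI)
    fix f assume wf: "w * f \<in> pair_pow J u v (Suc n)"
    then have "w * f \<in> adjoin (adjoin J u) (v ^ Suc n)" using pair_pow_subset[OF J] by blast
    then have "f \<in> adjoin (adjoin J u) (v ^ Suc n)"
      using nzdD nzd_adjoin_power[OF is_ideal_adjoin[OF J] v w] by blast
    then obtain j f1 h where f: "j \<in> J" "f = j + u * f1 + v ^ Suc n * h" by (metis adjoinE)
    have "w * f - w * j - v ^ Suc n * (w * h) \<in> pair_pow J u v (Suc n)"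
      using wf f(1) pair_pow_base[OF J, of u v "Suc n"] pair_pow_right[OF J]
      by (intro ideal_diff id) (auto intro: ideal_mult[OF id] simp del: pair_pow.simps power_Suc)
    then have "u * (w * f1) \<in> pair_pow J u v (Suc n)" using f by (simp add: algebra_simps)
    then have "w * f1 \<in> pair_pow J u v n" by (rule pair_pow_cancel[OF J u v])
    then have "f1 \<in> pair_pow J u v n" by (rule nzdD[OF Suc])
    then show "f \<in> pair_pow J u v (Suc n)" unfolding f(2) using f(1) by (rule pair_powI[rotated])
  qed
qed (simp add: nzd_def)

text \<open>Modulo \<open>u\<close> the ideals become principal and \<open>adjoin_prod_power\<close>
  intersects them. The remainder is a multiple of \<open>u\<close>, and cancelling \<open>u\<close>
  in each ideal lowers the exponent.\<close>

lemma pair_pow_INT: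
  assumes J: "is_ideal J" and B: "finite B" and u: "nzd J u"
    and v: "\<And>q. q \<in> B \<Longrightarrow> nzd (adjoin J u) (v q)"
    and vv: "\<And>q p. q \<in> B \<Longrightarrow> p \<in> B \<Longrightarrow> q \<noteq> p \<Longrightarrow> nzd (adjoin (adjoin J u) (v p)) (v q)"
    and f: "\<And>q. q \<in> B \<Longrightarrow> f \<in> pair_pow J u (v q) n"
  shows "f \<in> pair_pow J u (\<Prod>q\<in>B. v q) n"
  using f
proof (induction n arbitrary: f)
  case (Suc n)
  let ?V = "\<Prod>q\<in>B. v q"
  have "f \<in> adjoin (adjoin J u) (\<Prod>q\<in>B. v q ^ Suc n)"
  proof (rule adjoin_prod_power[OF is_ideal_adjoin[OF J] B v vv])
    fix r assume "r \<in> B"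
    then show "f \<in> adjoin (adjoin J u) (v r ^ Suc n)"
      using Suc.prems pair_pow_subset[OF J] by blast
  qed
  then obtain j g h where g: "j \<in> J" "f = j + u * g + ?V ^ Suc n * h"
    by (metis adjoinE prod_power_distrib)
  have "g \<in> pair_pow J u (v q) n" if q: "q \<in> B" for q
  proof (rule pair_pow_cancel[OF J u v[OF q]])
    note id = is_ideal_pair_pow[OF J, of u "v q" "Suc n"]
    have "?V ^ Suc n * h = v q ^ Suc n * ((\<Prod>q\<in>B-{q}. v q) ^ Suc n * h)"
      using B q by (simp add: prod.remove power_mult_distrib ac_simps)
    then have "?V ^ Suc n * h \<in> pair_pow J u (v q) (Suc n)" using pair_pow_right[OF J] by metis
    moreover have "j \<in> pair_pow J u (v q) (Suc n)" using pair_pow_base[OF J] g(1) by blast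
    ultimately have "f - j - ?V ^ Suc n * h \<in> pair_pow J u (v q) (Suc n)"
      using Suc.prems[OF q] by (intro ideal_diff id)
    then show "u * g \<in> pair_pow J u (v q) (Suc n)" using g(2) by simp
  qed
  then have "g \<in> pair_pow J u ?V n" by (rule Suc.IH)
  then show ?case unfolding g(2) using g(1) by (rule pair_powI[rotated])
qed simp

lemma pair_pow_mono_right:
  assumes J: "is_ideal J"
  shows "pair_pow J u (v * w) n \<subseteq> pair_pow J u v n"
proof (induction n)
  case (Suc n)
  show ?case
  proof
    fix x assume "x \<in> pair_pow J u (v * w) (Suc n)"
    then obtain j f h where "j \<in> J" "f \<in> pair_pow J u (v * w) n" "x = j + u * f + (v * w) ^ Suc n * h"
      by (rule pair_powE)
    then have *: "j \<in> J" "f \<in> pair_pow J u v n" "x = j + u * f + v ^ Suc n * (w ^ Suc n * h)"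
      using Suc by (auto simp: power_mult_distrib ac_simps)
    then show "x \<in> pair_pow J u v (Suc n)" by (metis pair_powI)
  qed
qed simp

lemma pair_pow_commute: "pair_pow {0} u v n = pair_pow {0} v u n"
  by (metis ideal_pow_pair insert_commute)

section \<open>Depth\<close>

lemma ideal_sum_mem: "is_ideal I \<Longrightarrow> (\<And>i. i \<in> A \<Longrightarrow> f i \<in> I) \<Longrightarrow> (\<Sum>i\<in>A. f i) \<in> I"
  by (induction A rule: infinite_finite_induct) (auto intro: ideal_zero ideal_add)

text \<open>The extended ideal \<open>J\<close> R[T], with quotient (R/J)[T].\<close>

definition poly_ext :: "'a::comm_ring_1 set \<Rightarrow> 'a poly set" where
  "poly_ext J = {p. \<forall>i. coeff p i \<in> J}"

lemma is_ideal_poly_ext: "is_ideal J \<Longrightarrow> is_ideal (poly_ext J)"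
  by (simp (no_asm) add: is_ideal_def poly_ext_def)
    (auto simp: coeff_mult intro!: ideal_zero ideal_add ideal_sum_mem ideal_mult)

lemma pCons_in_poly_ext: "pCons a p \<in> poly_ext J \<longleftrightarrow> a \<in> J \<and> p \<in> poly_ext J"
proof
  assume "pCons a p \<in> poly_ext J"
  then have *: "coeff (pCons a p) i \<in> J" for i by (simp add: poly_ext_def)
  show "a \<in> J \<and> p \<in> poly_ext J" using *[of 0] *[of "Suc _"] by (simp add: poly_ext_def)
qed (auto simp: poly_ext_def coeff_pCons split: nat.split)

lemma poly_ext_adjoin:
  assumes J: "is_ideal J" shows "poly_ext (adjoin J f) = adjoin (poly_ext J) [:f:]"
proof (rule set_eqI, rule iffI)
  fix p show "p \<in> poly_ext (adjoin J f) \<Longrightarrow> p \<in> adjoin (poly_ext J) [:f:]"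
  proof (induction p)
    case 0
    show ?case by (intro ideal_zero is_ideal_adjoin is_ideal_poly_ext J)
  next
    case (pCons a p)
    then have "a \<in> adjoin J f" "p \<in> adjoin (poly_ext J) [:f:]"
      by (auto simp: pCons_in_poly_ext)
    then obtain j r q s where *: "j \<in> J" "a = j + f * r" "q \<in> poly_ext J" "p = q + [:f:] * s"
      by (metis adjoinE)
    then have "pCons a p = pCons j q + [:f:] * pCons r s" by simp
    then show ?case using *(1,3) by (metis adjoinI pCons_in_poly_ext)
  qed
next
  fix p assume "p \<in> adjoin (poly_ext J) [:f:]"
  then obtain q s where "q \<in> poly_ext J" "p = q + [:f:] * s" by (rule adjoinE)
  then show "p \<in> poly_ext (adjoin J f)" by (auto simp: poly_ext_def intro: adjoinI)
qed

lemma nzd_poly_ext: "nzd J f \<Longrightarrow> nzd (poly_ext J) [:f:]"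
  by (auto simp: nzd_def poly_ext_def)

lemma has_socle_poly_ext:
  assumes M: "is_ideal M" and J: "is_ideal J"
  shows "has_socle (poly_ext M) (poly_ext J) \<longleftrightarrow> has_socle M J"
proof
  assume "has_socle (poly_ext M) (poly_ext J)"
  then obtain z where z: "z \<notin> poly_ext J" "\<And>a. a \<in> poly_ext M \<Longrightarrow> a * z \<in> poly_ext J"
    by (auto simp: has_socle_def)
  then obtain i where "coeff z i \<notin> J" by (auto simp: poly_ext_def)
  moreover have "a * coeff z i \<in> J" if "a \<in> M" for a
    using z(2)[of "[:a:]"] that ideal_zero[OF M]
    by (auto simp: poly_ext_def coeff_pCons split: nat.splits)
  ultimately show "has_socle M J" by (auto simp: has_socle_def)
next
  assume "has_socle M J"
  then obtain z where "z \<notin> J" "\<And>a. a \<in> M \<Longrightarrow> a * z \<in> J" by (auto simp: has_socle_def)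
  then have "[:z:] \<notin> poly_ext J" "\<And>a. a \<in> poly_ext M \<Longrightarrow> a * [:z:] \<in> poly_ext J"
    by (auto simp: pCons_in_poly_ext) (auto simp: poly_ext_def mult.commute[of z])
  then show "has_socle (poly_ext M) (poly_ext J)" by (auto simp: has_socle_def)
qed

text \<open>This is McCoy's theorem on zero divisors, over the ring \<open>R/J\<close>.\<close>
lemma mccoy:
  fixes g h :: "'a::comm_ring_1 poly"
  assumes J: "is_ideal J" and gh: "g * h \<in> poly_ext J" and h: "h \<notin> poly_ext J"
  shows "\<exists>z. z \<notin> J \<and> (\<forall>i. coeff g i * z \<in> J)"
proof -
  note ext = is_ideal_poly_ext[OF J]
  obtain h where h: "h \<notin> poly_ext J" "g * h \<in> poly_ext J"
    and min: "\<And>h'. h' \<notin> poly_ext J \<Longrightarrow> g * h' \<in> poly_ext J \<Longrightarrow> degree h \<le> degree h'"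
    using ex_has_least_nat[of "\<lambda>h. h \<notin> poly_ext J \<and> g * h \<in> poly_ext J" h degree] assms by blast
  define n where "n = degree h"
  have smult_mem: "smult c p \<in> poly_ext J" if "p \<in> poly_ext J" for c p
    using that J by (auto simp: poly_ext_def intro: ideal_mult)
  \<comment> \<open>Downward induction from the top coefficient of \<open>g\<close>: in degree
    \<open>i + n\<close> of \<open>g * h\<close>, larger indices of \<open>g\<close> contribute
    elements of \<open>J\<close> and smaller ones meet zero coefficients of
    \<open>h\<close>.\<close>
  have "smult (coeff g i) h \<in> poly_ext J" for i
  proof (induction "degree g - i" arbitrary: i rule: less_induct)
    case less
    have above: "coeff g k * coeff h l \<in> J" if "k > i" for k l
    proof (cases "k \<le> degree g")
      case True
      then have "smult (coeff g k) h \<in> poly_ext J" using less[of k] that by auto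
      then show ?thesis by (auto simp: poly_ext_def)
    next
      case False
      then show ?thesis using ideal_zero[OF J] by (simp add: coeff_eq_0)
    qed
    have "coeff (g * h) (i + n) \<in> J" using h by (auto simp: poly_ext_def)
    then have "(\<Sum>k\<le>i + n. coeff g k * coeff h (i + n - k)) \<in> J" by (simp add: coeff_mult)
    moreover have "(\<Sum>k\<in>{..i + n} - {i}. coeff g k * coeff h (i + n - k)) \<in> J"
    proof (rule ideal_sum_mem[OF J])
      fix k assume k: "k \<in> {..i + n} - {i}"
      show "coeff g k * coeff h (i + n - k) \<in> J"
      proof (cases "k < i")
        case True
        then have "coeff h (i + n - k) = 0" by (intro coeff_eq_0) (auto simp: n_def)
        then show ?thesis using ideal_zero[OF J] by simp
      qed (use above k in auto)
    qed
    ultimately have top: "coeff g i * coeff h n \<in> J"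
      using ideal_diff[OF J, of "\<Sum>k\<le>i + n. coeff g k * coeff h (i + n - k)"]
      by (subst (asm) sum.remove[of _ i]) (auto simp: algebra_simps dest: ideal_diff[OF J])
    \<comment> \<open>Without its top term the multiple of \<open>h\<close> has smaller degree and
      is still a partner of \<open>g\<close>, so the minimality of \<open>h\<close> forces it into
      the extended ideal.\<close>
    define h' where "h' = smult (coeff g i) h - monom (coeff g i * coeff h n) n"
    have mon: "monom (coeff g i * coeff h n) n \<in> poly_ext J"
      using top ideal_zero[OF J] by (auto simp: poly_ext_def)
    have "g * h' = smult (coeff g i) (g * h) - g * monom (coeff g i * coeff h n) n"
      by (simp add: h'_def algebra_simps)
    then have gh': "g * h' \<in> poly_ext J"
      using smult_mem[OF h(2)] ideal_mult[OF ext mon] ideal_diff[OF ext] by metis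
    show ?case
    proof (rule ccontr)
      assume "smult (coeff g i) h \<notin> poly_ext J"
      then have h': "h' \<notin> poly_ext J"
        using ideal_diff_iff[OF ext, of "smult (coeff g i) h" h'] mon by (simp add: h'_def)
      have "degree h' \<le> n"
        unfolding h'_def n_def by (intro degree_diff_le degree_smult_le degree_monom_le)
      moreover have "degree h' \<ge> n" using min[OF h' gh'] by (simp add: n_def)
      moreover have "coeff h' n = 0" by (simp add: h'_def)
      ultimately have "h' = 0" using leading_coeff_0_iff[of h'] by simp
      then show False using h' ideal_zero[OF ext] by simp
    qed
  qed
  moreover obtain j where "coeff h j \<notin> J" using h by (auto simp: poly_ext_def)
  ultimately show ?thesis by (auto simp: poly_ext_def)
qed

text \<open>For a zero divisor, McCoy gives a constant \<open>z\<close> that kills all its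
  coefficients, here the generators \<open>xs\<close>, and hence the ideal they generate.\<close>

lemma nzd_generic_combination:
  assumes J: "is_ideal J" and soc: "\<not> has_socle (ideal_gen (set xs)) J"
  shows "nzd (poly_ext J) (Poly xs)"
  unfolding nzd_def
proof (intro allI impI, rule ccontr)
  fix h assume "Poly xs * h \<in> poly_ext J" "h \<notin> poly_ext J"
  from mccoy[OF J this] obtain z where z: "z \<notin> J" "\<And>i. coeff (Poly xs) i * z \<in> J" by blast
  have "set xs \<subseteq> {a. a * z \<in> J}"
    using z(2) by (auto simp: in_set_conv_nth) (metis coeff_Poly_eq nth_default_nth)
  moreover have "is_ideal {a. a * z \<in> J}"
    using J by (auto simp: is_ideal_def algebra_simps)
  ultimately have "ideal_gen (set xs) \<subseteq> {a. a * z \<in> J}" by (intro ideal_gen_least)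
  then show False using soc z(1) by (auto simp: has_socle_def)
qed

text \<open>A generic linear combination of the generators of \<open>M\<close> over \<open>R[T]\<close> is regular wherever
  some element of \<open>M\<close> is; exchanging through it replaces prime avoidance.\<close>
lemma has_socle_regular_pairs:
  assumes I: "is_ideal I" and M: "M = ideal_gen (set xs)"
    and "l1 \<in> M" "l2 \<in> M" and l1: "nzd I l1" and l2: "nzd (adjoin I l1) l2"
    and soc: "has_socle M (adjoin (adjoin I l1) l2)"
    and "f1 \<in> M" "f2 \<in> M" and f1: "nzd I f1" and f2: "nzd (adjoin I f1) f2"
  shows "has_socle M (adjoin (adjoin I f1) f2)"
proof -
  define I' M' g where "I' = poly_ext I" and "M' = poly_ext M" and "g = Poly xs"
  have idM: "is_ideal M" unfolding M by (rule is_ideal_ideal_gen)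
  have I': "is_ideal I'" unfolding I'_def by (rule is_ideal_poly_ext[OF I])
  have const: "[:a:] \<in> M'" if "a \<in> M" for a
    using that ideal_zero[OF is_ideal_poly_ext[OF idM]] by (simp add: M'_def pCons_in_poly_ext)
  have gM: "g \<in> M'"
    using ideal_gen_superset[of "set xs"] ideal_zero[OF idM]
    by (auto simp: g_def M'_def poly_ext_def nth_default_def M)
  have ext: "poly_ext (adjoin I a) = adjoin I' [:a:]"
    "poly_ext (adjoin (adjoin I a) b) = adjoin (adjoin I' [:a:]) [:b:]" for a b
    by (simp_all add: I'_def poly_ext_adjoin I is_ideal_adjoin)
  have generic: "nzd (adjoin I' [:a:]) g" if "nzd (adjoin I a) b" "b \<in> M" for a b
    using nzd_generic_combination[of "adjoin I a" xs] nzd_not_has_socle[OF that] I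
    by (simp add: is_ideal_adjoin ext M[symmetric] g_def)
  have gI: "nzd I' g"
    using nzd_generic_combination[of I xs] nzd_not_has_socle[OF l1 \<open>l1 \<in> M\<close>] I
    by (simp add: M[symmetric] g_def I'_def)
  have swap: "nzd (adjoin I' g) [:a:]" if "nzd I a" "nzd (adjoin I a) b" "b \<in> M" for a b
    using nzd_adjoin_swap[OF I'] generic[OF that(2,3)] nzd_poly_ext[OF that(1)] by (simp add: I'_def)
  note id = is_ideal_adjoin[OF I']
  note com = adjoin_commute[OF I']
  have l2': "nzd (adjoin I' [:l1:]) [:l2:]" using nzd_poly_ext[OF l2] by (simp add: ext)
  have f2': "nzd (adjoin I' [:f1:]) [:f2:]" using nzd_poly_ext[OF f2] by (simp add: ext)
  \<comment> \<open>The pairs run through (l1, l2), (g, l1), (g, f1), (f1, f2). Each move exchanges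
    one element over a fixed other one; \<open>generic\<close> and \<open>swap\<close> provide the
    regularity on both sides.\<close>
  have "has_socle M' (adjoin (adjoin I' [:l1:]) [:l2:])"
    using soc has_socle_poly_ext[OF idM, of "adjoin (adjoin I l1) l2"] I
    by (simp add: is_ideal_adjoin ext M'_def)
  then have "has_socle M' (adjoin (adjoin I' g) [:l1:])"
    using has_socle_exchange[OF id generic[OF l2 \<open>l2 \<in> M\<close>] l2' gM] com by simp
  then have "has_socle M' (adjoin (adjoin I' g) [:f1:])"
    using has_socle_exchange[OF id swap[OF f1 f2 \<open>f2 \<in> M\<close>] swap[OF l1 l2 \<open>l2 \<in> M\<close>] const]
      \<open>f1 \<in> M\<close> by blast
  then have "has_socle M' (adjoin (adjoin I' [:f1:]) [:f2:])"
    using has_socle_exchange[OF id f2' generic[OF f2 \<open>f2 \<in> M\<close>] const] \<open>f2 \<in> M\<close> com by simp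
  then show ?thesis
    using has_socle_poly_ext[OF idM, of "adjoin (adjoin I f1) f2"] I
    by (simp add: is_ideal_adjoin ext M'_def)
qed

section \<open>Regular sequences and bounds for the depth\<close>

lemma regular_seq_nzd:
  "regular_seq I fs \<Longrightarrow> i < length fs \<Longrightarrow> nzd (ideal_sum I (ideal_gen (set (take i fs)))) (fs ! i)"
  by (auto simp: regular_seq_def nzd_def)

lemma regular_seq_two:
  assumes "is_ideal I" "regular_seq I (f1 # f2 # fs)"
  shows "nzd I f1" "nzd (adjoin I f1) f2"
  using regular_seq_nzd[OF assms(2), of 0] regular_seq_nzd[OF assms(2), of 1] assms(1)
  by (auto simp: ideal_sum_empty ideal_sum_insert simp del: insert_iff)

lemma regular_seq_three:
  assumes "is_ideal I" "regular_seq I (f1 # f2 # f3 # fs)"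
  shows "nzd (adjoin (adjoin I f1) f2) f3"
  using regular_seq_nzd[OF assms(2), of 2] assms(1)
  by (auto simp: ideal_sum_empty ideal_sum_insert adjoin_commute numeral_2_eq_2)

lemma regular_seq_pairI:
  assumes "is_ideal I" "nzd I f" "nzd (adjoin I f) g" "adjoin (adjoin I f) g \<noteq> UNIV"
  shows "regular_seq I [f, g]"
  using assms unfolding regular_seq_def
  by (auto simp: less_Suc_eq ideal_sum_empty ideal_sum_insert adjoin_commute dest: nzdD)

text \<open>The socle modulo \<open>l\<close> moves to a socle modulo the first entry of any
  nonempty regular sequence, where it rules out a second entry.\<close>

lemma depth_quot_le_one:
  assumes I: "is_ideal I" and l: "l \<in> irrelevant_ideal" "nzd I l"
    and soc: "has_socle irrelevant_ideal (adjoin I l)"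
  shows "depth_quot I \<le> 1"
  unfolding depth_quot_def
proof (rule Sup_least, clarify)
  fix fs assume fs: "set fs \<subseteq> irrelevant_ideal" "regular_seq I fs"
  have "length fs \<le> 1"
  proof (rule ccontr)
    assume "\<not> length fs \<le> 1"
    then obtain f1 f2 gs where fs': "fs = f1 # f2 # gs" by (cases fs rule: remdups_adj.cases) auto
    have "has_socle irrelevant_ideal (adjoin I f1)"
      using has_socle_exchange[OF I regular_seq_two(1)[OF I] l(2) _ soc] fs fs' by auto
    moreover have "nzd (adjoin I f1) f2" using regular_seq_two(2)[OF I] fs fs' by auto
    ultimately show False using nzd_not_has_socle fs fs' by auto
  qed
  then show "enat (length fs) \<le> 1" by (simp add: one_enat_def)
qed

lemma irrelevant_ideal_list: "irrelevant_ideal = ideal_gen (set [Var X0, Var X1, Var Y0, Var Y1])"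
proof -
  have *: "UNIV = {X0, X1, Y0, Y1}" by (auto intro: var.exhaust)
  show ?thesis unfolding irrelevant_ideal_def * by simp
qed

text \<open>A third entry would be regular on a quotient that inherits a socle by
  \<open>has_socle_regular_pairs\<close>. The socle element also shows that the quotient by
  \<open>l1\<close> and \<open>l2\<close> is nonzero, as a regular sequence demands.\<close>

lemma depth_quot_eq_two:
  assumes I: "is_ideal I" and l1: "l1 \<in> irrelevant_ideal" "nzd I l1"
    and l2: "l2 \<in> irrelevant_ideal" "nzd (adjoin I l1) l2"
    and soc: "has_socle irrelevant_ideal (adjoin (adjoin I l1) l2)"
  shows "depth_quot I = 2"
proof (rule antisym)
  show "depth_quot I \<le> 2"
    unfolding depth_quot_def
  proof (rule Sup_least, clarify)
    fix fs assume fs: "set fs \<subseteq> irrelevant_ideal" "regular_seq I fs"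
    have "length fs \<le> 2"
    proof (rule ccontr)
      assume "\<not> length fs \<le> 2"
      then obtain f1 f2 f3 gs where fs': "fs = f1 # f2 # f3 # gs"
        by (cases fs rule: remdups_adj.cases; cases "tl (tl fs)") auto
      have "has_socle irrelevant_ideal (adjoin (adjoin I f1) f2)"
        using has_socle_regular_pairs[OF I irrelevant_ideal_list l1(1) l2(1) l1(2) l2(2) soc]
          regular_seq_two[OF I] fs fs' by auto
      moreover have "nzd (adjoin (adjoin I f1) f2) f3" using regular_seq_three[OF I] fs fs' by auto
      ultimately show False using nzd_not_has_socle fs fs' by auto
    qed
    then show "enat (length fs) \<le> 2" by (simp add: numeral_eq_enat)
  qed
  have "adjoin (adjoin I l1) l2 \<noteq> UNIV" using soc by (auto simp: has_socle_def)
  then have "regular_seq I [l1, l2]" using regular_seq_pairI[OF I l1(2) l2(2)] by blast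
  then have "enat (length [l1, l2]) \<le> depth_quot I"
    unfolding depth_quot_def using l1 l2
    by (intro Sup_upper CollectI exI[of _ "[l1, l2]"]) auto
  then show "2 \<le> depth_quot I" by (simp add: numeral_eq_enat numeral_2_eq_2)
qed

section \<open>Ring homomorphisms and chains of primes\<close>

definition is_hom :: "('a::comm_ring_1 \<Rightarrow> 'b::comm_ring_1) \<Rightarrow> bool" where
  "is_hom h \<longleftrightarrow> h 1 = 1 \<and> (\<forall>a b. h (a + b) = h a + h b) \<and> (\<forall>a b. h (a * b) = h a * h b)"

lemma is_homD:
  assumes "is_hom h"
  shows "h 1 = 1" "h (a + b) = h a + h b" "h (a * b) = h a * h b"
    "h 0 = 0" "h (- a) = - h a" "h (a - b) = h a - h b"
proof -
  show *: "h 1 = 1" "h (a + b) = h a + h b" "h (a * b) = h a * h b" for a b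
    using assms by (auto simp: is_hom_def)
  show 0: "h 0 = 0" using *(2)[of 0 0] by simp
  show m: "h (- a) = - h a" for a using *(2)[of a "- a"] 0 by (simp add: eq_neg_iff_add_eq_0 add.commute)
  show "h (a - b) = h a - h b" using *(2)[of a "- b"] m[of b] by simp
qed

lemma is_ideal_vimage: "is_hom h \<Longrightarrow> is_ideal I \<Longrightarrow> is_ideal (h -` I)"
  by (auto simp: is_ideal_def is_homD)

lemma prime_ideal_vimage: "is_hom h \<Longrightarrow> prime_ideal P \<Longrightarrow> prime_ideal (h -` P)"
  using is_ideal_vimage[of h P] ideal_eq_UNIV[of P]
  by (auto simp: prime_ideal_def is_homD) (metis UNIV_I is_homD(1) vimage_eq)

lemma is_hom_poly:
  assumes h: "is_hom h" shows "is_hom (\<lambda>p. poly (map_poly h p) x)"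
proof -
  let ?e = "\<lambda>p. poly (map_poly h p) x"
  note [simp] = is_homD[OF h]
  have cons: "?e (pCons a p) = h a + x * ?e p" for a p
    by (simp add: map_poly_pCons)
  have add: "?e (p + q) = ?e p + ?e q" for p q
    by (induction p q rule: poly_induct2) (simp_all add: cons algebra_simps)
  have smult: "?e (smult a p) = h a * ?e p" for a p
    by (induction p) (simp_all add: cons algebra_simps)
  have "?e (p * q) = ?e p * ?e q" for p q
    by (induction p) (simp_all add: cons add smult algebra_simps)
  moreover have "?e 1 = 1" by (simp add: map_poly_1)
  ultimately show ?thesis using add by (auto simp: is_hom_def)
qed

text \<open>Polynomials split over an algebraically closed field, and nonzero constants stay units
  under \<open>h\<close>. The homomorphism lets the polynomial be in either variable of
  k[s][t].\<close>

lemma prime_ideal_contains_linear_factor: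
  fixes p :: "'k::alg_closed_field poly"
  assumes P: "prime_ideal P" and h: "is_hom h" and "h p \<in> P" "p \<noteq> 0"
  shows "\<exists>a. h [:- a, 1:] \<in> P"
  using assms(3,4)
proof (induction "degree p" arbitrary: p rule: less_induct)
  case less
  note id = prime_ideal_is_ideal[OF P]
  show ?case
  proof (cases "degree p = 0")
    case True
    then obtain c where c: "p = [:c:]" "c \<noteq> 0" using less.prems by (metis degree_0_id pCons_0_0)
    have "1 = [:inverse c:] * p" using c by (simp add: one_pCons)
    then have "1 \<in> P" using less.prems(1) ideal_mult[OF id] is_homD[OF h] by metis
    then show ?thesis using P ideal_eq_UNIV by (auto simp: prime_ideal_def)
  next
    case False
    then obtain a where "poly p a = 0" using alg_closed_imp_poly_has_root by auto
    then obtain q where q: "p = [:- a, 1:] * q" by (metis dvd_def poly_eq_0_iff_dvd)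
    then have "q \<noteq> 0" using less.prems by auto
    then have "degree p = Suc (degree q)" unfolding q by (subst degree_mult_eq) auto
    moreover have "h [:- a, 1:] \<in> P \<or> h q \<in> P"
      using P less.prems(1) by (simp only: q is_homD[OF h] prime_ideal_def)
    ultimately show ?thesis using less.hyps[of q] \<open>q \<noteq> 0\<close> by auto
  qed
qed

lemma is_hom_const_poly: "is_hom (\<lambda>c. [:c:])"
  by (auto simp: is_hom_def one_pCons)

text \<open>The coefficientwise embedding is an evaluation at the outer variable, so
  \<open>is_hom_poly\<close> applies.\<close>

lemma is_hom_map_const: "is_hom (map_poly (\<lambda>c :: 'a::comm_ring_1. [:c:]))"
proof -
  have "is_hom (\<lambda>p. poly (map_poly (\<lambda>c :: 'a. [:[:c:]:]) p) [:0, 1:])"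
    by (rule is_hom_poly) (auto simp: is_hom_def one_pCons)
  moreover have "poly (map_poly (\<lambda>c :: 'a. [:[:c:]:]) p) [:0, 1:] = map_poly (\<lambda>c. [:c:]) p" for p
    by (induction p) (simp_all add: map_poly_pCons)
  ultimately show ?thesis by simp
qed

section \<open>Chains of primes in the polynomial ring in two variables\<close>

lemma poly_poly_residue:
  fixes P :: "'k::comm_ring_1 poly poly set"
  assumes P: "is_ideal P" and a: "[:[:- a, 1:]:] \<in> P"
  shows "f - map_poly (\<lambda>c. [:c:]) (map_poly (\<lambda>c. poly c a) f) \<in> P"
proof (induction f)
  case 0 then show ?case using ideal_zero[OF P] by simp
next
  case (pCons c f)
  have "poly (c - [:poly c a:]) a = 0" by simp
  then obtain d where "c - [:poly c a:] = [:- a, 1:] * d" by (metis dvd_def poly_eq_0_iff_dvd)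
  then have "[:c - [:poly c a:]:] = [:[:- a, 1:]:] * [:d:]" by simp
  then have 1: "[:c - [:poly c a:]:] \<in> P" using a ideal_mult_right[OF P] by metis
  let ?r = "\<lambda>f. map_poly (\<lambda>c. [:c:]) (map_poly (\<lambda>c. poly c a) f)"
  have "pCons c f - ?r (pCons c f) = [:c - [:poly c a:]:] + [:0, 1:] * (f - ?r f)"
    by (simp add: map_poly_pCons)
  then show ?case using 1 pCons ideal_add[OF P] ideal_mult[OF P] by metis
qed

text \<open>With the zero ideal below, this bounds the dimension of k[s][t] by two. If
  \<open>P2\<close> contains a nonzero polynomial in the inner variable s, it contains some s - a
  and is either maximal or generated by s - a; otherwise pseudo-division by an element of least
  degree gives \<open>P1 = P2\<close>.\<close>

lemma prime_chain_poly_poly: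
  fixes P1 P2 P3 :: "'k::alg_closed_field poly poly set"
  assumes P: "prime_ideal P1" "prime_ideal P2" "prime_ideal P3" and sub: "P1 \<subset> P2" "P2 \<subset> P3"
    and nz: "f \<in> P1" "f \<noteq> 0"
  shows False
proof (cases "\<exists>c. c \<noteq> 0 \<and> [:c:] \<in> P2")
  case True
  note id = P[THEN prime_ideal_is_ideal]
  obtain a where a: "[:[:- a, 1:]:] \<in> P2"
    using True prime_ideal_contains_linear_factor[OF P(2) is_hom_const_poly] by blast
  let ?r = "\<lambda>f. map_poly (\<lambda>c. poly c a) f"
  show False
  proof (cases "\<exists>g\<in>P2. ?r g \<noteq> 0")
    \<comment> \<open>Here \<open>P2\<close> also contains t - b, so an element of \<open>P3\<close>
      outside \<open>P2\<close> is congruent to a nonzero constant, which would be a unit in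
      \<open>P3\<close>.\<close>
    case True
    then obtain g where g: "g \<in> P2" "?r g \<noteq> 0" by blast
    then have "map_poly (\<lambda>c. [:c:]) (?r g) \<in> P2"
      using ideal_diff_iff[OF id(2) poly_poly_residue[OF id(2) a]] by blast
    then obtain b where "map_poly (\<lambda>c. [:c:]) [:- b, 1:] \<in> P2"
      using prime_ideal_contains_linear_factor[OF P(2) is_hom_map_const _ g(2)] by blast
    then have b: "[:[:- b:], 1:] \<in> P2" by (simp add: map_poly_pCons one_pCons)
    have "x \<in> P2" if x: "x \<in> P3" for x
    proof (rule ccontr)
      assume "x \<notin> P2"
      let ?y = "map_poly (\<lambda>c. [:c:]) (?r x)"
      have "?y - [:[:poly (?r x) b:]:] \<in> P2"
      proof -
        have "poly (?r x - [:poly (?r x) b:]) b = 0" by simp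
        then obtain d where d: "?r x - [:poly (?r x) b:] = [:- b, 1:] * d"
          by (metis dvd_def poly_eq_0_iff_dvd)
        have "?y - [:[:poly (?r x) b:]:] = map_poly (\<lambda>c. [:c:]) (?r x - [:poly (?r x) b:])"
          by (simp add: is_homD[OF is_hom_map_const] map_poly_pCons)
        also have "\<dots> = [:[:- b:], 1:] * map_poly (\<lambda>c. [:c:]) d"
          unfolding d is_homD(3)[OF is_hom_map_const] by (simp add: map_poly_pCons one_pCons)
        finally show ?thesis using b ideal_mult_right[OF id(2)] by metis
      qed
      from ideal_add[OF id(2) poly_poly_residue[OF id(2) a, of x] this]
      have "x - [:[:poly (?r x) b:]:] \<in> P2" by (simp only: add_diff_eq diff_add_cancel)
      moreover from this have "[:[:poly (?r x) b:]:] \<in> P3"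
        using ideal_diff_iff[OF id(3)] sub x by blast
      moreover have "poly (?r x) b \<noteq> 0"
        using \<open>x \<notin> P2\<close> calculation(1) by auto
      then have "1 = [:[:inverse (poly (?r x) b):]:] * [:[:poly (?r x) b:]:]" by (simp add: one_pCons)
      ultimately have "1 \<in> P3" using ideal_mult[OF id(3)] by metis
      then show False using P(3) ideal_eq_UNIV by (auto simp: prime_ideal_def)
    qed
    then show False using sub by blast
  next
    case False
    \<comment> \<open>All residues vanish, so s - a divides every element of \<open>P2\<close>; if
      it lay in \<open>P1\<close>, the two primes would coincide.\<close>
    have a1: "[:[:- a, 1:]:] \<notin> P1"
    proof
      assume a1: "[:[:- a, 1:]:] \<in> P1"
      have "g \<in> P1" if "g \<in> P2" for g
        using poly_poly_residue[OF id(1) a1, of g] False that by simp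
      then show False using sub by blast
    qed
    \<comment> \<open>descent on the degree of the leading coefficient\<close>
    obtain f where f: "f \<in> P1" "f \<noteq> 0"
      and min: "\<And>g. g \<in> P1 \<Longrightarrow> g \<noteq> 0 \<Longrightarrow> degree (lead_coeff f) \<le> degree (lead_coeff g)"
      using ex_has_least_nat[of "\<lambda>f. f \<in> P1 \<and> f \<noteq> 0" f "\<lambda>f. degree (lead_coeff f)"] nz by blast
    have "?r f = 0" using False f sub by blast
    then have "poly (coeff f i) a = 0" for i by (metis coeff_0 coeff_map_poly poly_0)
    then have "[:- a, 1:] dvd coeff f i" for i by (simp add: poly_eq_0_iff_dvd)
    then have "[:[:- a, 1:]:] dvd f" by (simp add: const_poly_dvd_iff)
    then obtain g where g: "f = [:[:- a, 1:]:] * g" by (auto elim: dvdE)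
    then have "g \<in> P1" using f a1 P(1) by (metis prime_ideal_def)
    moreover have "g \<noteq> 0" using f g by auto
    moreover have "lead_coeff f = [:- a, 1:] * lead_coeff g" unfolding g by (subst lead_coeff_mult) simp
    then have "degree (lead_coeff f) = Suc (degree (lead_coeff g))"
      using \<open>g \<noteq> 0\<close> by (simp only:) (subst degree_mult_eq, auto)
    ultimately show False using min by fastforce
  qed
next
  case no_const: False
  note id = P[THEN prime_ideal_is_ideal]
  obtain h where h: "h \<in> P1" "h \<noteq> 0"
    and minh: "\<And>g. g \<in> P1 \<Longrightarrow> g \<noteq> 0 \<Longrightarrow> degree h \<le> degree g"
    using ex_has_least_nat[of "\<lambda>f. f \<in> P1 \<and> f \<noteq> 0" f degree] nz by blast
  have "f \<in> P2" using nz sub by auto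
  then obtain f where f: "f \<in> P2" "f \<noteq> 0"
    and minf: "\<And>g. g \<in> P2 \<Longrightarrow> g \<noteq> 0 \<Longrightarrow> degree f \<le> degree g"
    using ex_has_least_nat[of "\<lambda>f. f \<in> P2 \<and> f \<noteq> 0" f degree] nz by blast
  define c where "c = lead_coeff f"
  have c: "c \<noteq> 0" using f by (simp add: c_def)
  have degf: "degree f > 0"
  proof (rule ccontr)
    assume "\<not> degree f > 0"
    then have "f = [:lead_coeff f:]" by (metis degree_0_id gr0I)
    then show False using no_const f c by (metis c_def)
  qed
  have c2: "[:c ^ n:] \<notin> P2" for n using no_const c by (metis power_not_zero)
  \<comment> \<open>A nonzero remainder would have smaller degree than \<open>f\<close>. Hence
    \<open>f\<close> divides each element of \<open>P2\<close> up to a power of its leading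
    coefficient, and that power lies outside \<open>P2\<close>.\<close>
  have div: "\<exists>q n. [:c ^ n:] * g = f * q" if g: "g \<in> P2" for g
  proof -
    obtain q r where qr: "pseudo_divmod g f = (q, r)" by (metis surj_pair)
    define n where "n = Suc (degree g) - degree f"
    from pseudo_divmod[OF f(2) qr] have *: "smult (c ^ n) g = f * q + r" "r = 0 \<or> degree r < degree f"
      by (auto simp: c_def n_def)
    have "r = [:c ^ n:] * g - f * q" using *(1) by simp
    then have "r \<in> P2" using ideal_diff[OF id(2)] ideal_mult[OF id(2) g] ideal_mult_right[OF id(2) f(1)] by metis
    then have "r = 0" using *(2) minf by fastforce
    then show ?thesis using * by (intro exI[of _ q] exI[of _ n]) simp
  qed
  \<comment> \<open>Otherwise the quotient \<open>q\<close> would lie in \<open>P1\<close> with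
    smaller degree than \<open>h\<close>, as \<open>f\<close> has positive degree.\<close>
  have f1: "f \<in> P1"
  proof (rule ccontr)
    assume "f \<notin> P1"
    obtain q n where q: "[:c ^ n:] * h = f * q" using div h sub by blast
    then have "f * q \<in> P1" using h ideal_mult[OF id(1)] by metis
    then have "q \<in> P1" using \<open>f \<notin> P1\<close> P(1) by (auto simp: prime_ideal_def)
    moreover have "q \<noteq> 0" using q h c by auto
    moreover have "degree h = degree f + degree q"
      using arg_cong[OF q, of degree] \<open>q \<noteq> 0\<close> f h c by (simp add: degree_mult_eq)
    ultimately show False using minh degf by fastforce
  qed
  have "g \<in> P1" if g: "g \<in> P2" for g
  proof -
    obtain q n where "[:c ^ n:] * g = f * q" using div g by blast
    then have "[:c ^ n:] * g \<in> P1" using f1 ideal_mult_right[OF id(1)] by metis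
    moreover have "[:c ^ n:] \<notin> P1" using c2 sub by blast
    ultimately show ?thesis using P(1) unfolding prime_ideal_def by blast
  qed
  then show False using sub by blast
qed

section \<open>The polynomial ring and its linear primes\<close>

fun var_index :: "var \<Rightarrow> nat" where
  "var_index X0 = 0" | "var_index X1 = 1" | "var_index Y0 = 2" | "var_index Y1 = 3"

lemma var_index_inject: "var_index v = var_index w \<longleftrightarrow> v = w"
  by (cases v; cases w) auto

text \<open>The order on the variables makes the polynomial ring an instance of \<open>idom\<close>.\<close>
instantiation var :: linorder
begin

definition less_eq_var :: "var \<Rightarrow> var \<Rightarrow> bool" where
  "less_eq_var v w \<longleftrightarrow> var_index v \<le> var_index w"

definition less_var :: "var \<Rightarrow> var \<Rightarrow> bool" where
  "less_var v w \<longleftrightarrow> var_index v < var_index w"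

instance
  by standard (auto simp: less_eq_var_def less_var_def var_index_inject)

end

lemma Const_add: "Const (a + b) = Const a + Const b"
  and Const_mult: "Const (a * b) = Const a * Const b"
  and Const_uminus: "Const (- a) = - Const a"
  and Const_diff: "Const (a - b) = Const a - Const b"
  and Const_zero: "Const 0 = 0" and Const_one: "Const 1 = 1"
  by (simp_all add: Const_def single_add mult_single single_uminus single_diff)

lemma Const_eq_0_iff: "Const a = 0 \<longleftrightarrow> a = 0"
  by (metis Const_def lookup_single_eq lookup_zero single_zero)

lemma Var_neq_0: "Var v \<noteq> (0 :: 'k::comm_ring_1 bpoly)"
  by (metis Var_def lookup_single_eq lookup_zero zero_neq_one)

lemma is_hom_Const: "is_hom Const"
  by (simp add: is_hom_def Const_add Const_mult Const_one)

lemma poly_mapping_sum_single: "f = (\<Sum>\<mu>\<in>Poly_Mapping.keys f. Poly_Mapping.single \<mu> (Poly_Mapping.lookup f \<mu>))"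
proof (rule poly_mapping_eqI)
  fix k
  have "(\<Sum>\<mu>\<in>Poly_Mapping.keys f. Poly_Mapping.lookup f \<mu> when \<mu> = k) =
      (if k \<in> Poly_Mapping.keys f then Poly_Mapping.lookup f k else 0)"
    by (simp add: when_def sum.delta)
  then show "Poly_Mapping.lookup f k =
      Poly_Mapping.lookup (\<Sum>\<mu>\<in>Poly_Mapping.keys f. Poly_Mapping.single \<mu> (Poly_Mapping.lookup f \<mu>)) k"
    by (simp add: lookup_sum lookup_single in_keys_iff)
qed

lemma poly_mapping_single_induct:
  assumes "\<And>\<mu> a. P (Poly_Mapping.single \<mu> a)" and "\<And>f g. P f \<Longrightarrow> P g \<Longrightarrow> P (f + g)"
  shows "P (f :: 'a \<Rightarrow>\<^sub>0 'b::comm_monoid_add)"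
proof -
  have "P (\<Sum>\<mu>\<in>A. Poly_Mapping.single \<mu> (g \<mu>))" for A and g :: "'a \<Rightarrow> 'b"
    using assms(1)[of undefined 0]
    by (induction A rule: infinite_finite_induct) (auto intro: assms)
  then show ?thesis by (subst poly_mapping_sum_single)
qed

lemma Var_power: "Var v ^ n = Poly_Mapping.single (Poly_Mapping.single v n) 1"
  by (induction n) (simp_all add: Var_def mult_single flip: single_add)

lemma single_eq_monomial:
  "Poly_Mapping.single \<mu> a = Const a * (\<Prod>v\<in>{X0, X1, Y0, Y1}. Var v ^ Poly_Mapping.lookup \<mu> v)"
proof -
  have "\<mu> = (\<Sum>v\<in>{X0, X1, Y0, Y1}. Poly_Mapping.single v (Poly_Mapping.lookup \<mu> v))"
  proof (rule poly_mapping_eqI)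
    fix k show "Poly_Mapping.lookup \<mu> k =
      Poly_Mapping.lookup (\<Sum>v\<in>{X0, X1, Y0, Y1}. Poly_Mapping.single v (Poly_Mapping.lookup \<mu> v)) k"
      by (cases k) (simp_all add: lookup_add lookup_single)
  qed
  then show ?thesis
    by (simp add: Var_power mult_single Const_def add.assoc)
qed

lemma bpoly_induct [case_names Const Var add mult]:
  fixes f :: "'k::comm_ring_1 bpoly"
  assumes C: "\<And>c. P (Const c)" and V: "\<And>v. P (Var v)"
    and add: "\<And>f g. P f \<Longrightarrow> P g \<Longrightarrow> P (f + g)" and mult: "\<And>f g. P f \<Longrightarrow> P g \<Longrightarrow> P (f * g)"
  shows "P f"
proof (induction f rule: poly_mapping_single_induct)
  case (1 \<mu> a)
  have pw: "P (Var v ^ n)" for v n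
    using C[of 1] by (induction n) (auto simp: Const_one intro: V mult)
  show ?case unfolding single_eq_monomial by (auto intro!: mult pw C)
qed (rule add)

definition bsubst :: "(var \<Rightarrow> 'k bpoly) \<Rightarrow> 'k::comm_ring_1 bpoly \<Rightarrow> 'k bpoly" where
  "bsubst c f = (\<Sum>\<mu>\<in>Poly_Mapping.keys f.
     Const (Poly_Mapping.lookup f \<mu>) * (\<Prod>v\<in>{X0, X1, Y0, Y1}. c v ^ Poly_Mapping.lookup \<mu> v))"

lemma bsubst_superset:
  assumes "finite A" "Poly_Mapping.keys f \<subseteq> A"
  shows "bsubst c f = (\<Sum>\<mu>\<in>A.
     Const (Poly_Mapping.lookup f \<mu>) * (\<Prod>v\<in>{X0, X1, Y0, Y1}. c v ^ Poly_Mapping.lookup \<mu> v))"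
  unfolding bsubst_def using assms
  by (intro sum.mono_neutral_left) (auto simp: in_keys_iff Const_zero)

lemma bsubst_add: "bsubst c (f + g) = bsubst c f + bsubst c g"
proof -
  let ?A = "Poly_Mapping.keys f \<union> Poly_Mapping.keys g"
  have "Poly_Mapping.keys (f + g) \<subseteq> ?A" by (rule keys_add)
  then show ?thesis
    by (simp add: bsubst_superset[of ?A] lookup_add Const_add distrib_right sum.distrib del: prod.insert)
qed

lemma bsubst_single:
  "bsubst c (Poly_Mapping.single \<mu> a) = Const a * (\<Prod>v\<in>{X0, X1, Y0, Y1}. c v ^ Poly_Mapping.lookup \<mu> v)"
  by (subst bsubst_superset[of "{\<mu>}"]) auto

lemma is_hom_bsubst: "is_hom (bsubst c)"
proof -
  have "bsubst c (f * g) = bsubst c f * bsubst c g" for f g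
  proof (induction f rule: poly_mapping_single_induct)
    case (1 \<mu> a)
    show ?case
    proof (induction g rule: poly_mapping_single_induct)
      case (1 \<nu> b)
      show ?case
        unfolding mult_single bsubst_single lookup_add power_add prod.distrib Const_mult
        by (simp only: ac_simps)
    qed (simp add: distrib_left bsubst_add)
  qed (simp add: distrib_right bsubst_add)
  moreover have "bsubst c 1 = 1"
    using bsubst_single[of c 0 1] by (simp add: Const_one)
  ultimately show ?thesis by (simp add: is_hom_def bsubst_add)
qed

lemma bsubst_Const: "bsubst c (Const a) = Const a"
  unfolding Const_def by (subst bsubst_single) (simp add: Const_def)

lemma bsubst_Var: "bsubst c (Var v) = c v"
  unfolding Var_def by (subst bsubst_single) (cases v; simp add: Const_one lookup_single)

lemmas bsubst_simps = bsubst_Const bsubst_Var is_homD[OF is_hom_bsubst]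

text \<open>Substituting \<open>c\<close> changes no class modulo \<open>J\<close>. Over a field the
  target is a domain, so an ideal recognised in this way is prime.\<close>

lemma bsubst_kernel:
  fixes J :: "'k::comm_ring_1 bpoly set"
  assumes J: "is_ideal J" and c: "\<And>v. c v - Var v \<in> J" and ker: "\<And>f. f \<in> J \<Longrightarrow> bsubst c f = 0"
  shows "f \<in> J \<longleftrightarrow> bsubst c f = 0"
proof -
  have "bsubst c f - f \<in> J"
  proof (induction f rule: bpoly_induct)
    case (Const a) then show ?case using ideal_zero[OF J] by (simp add: bsubst_simps)
  next
    case (Var v) then show ?case using c by (simp add: bsubst_simps)
  next
    case (add f g)
    then show ?case using ideal_add[OF J add] by (simp add: bsubst_simps algebra_simps)
  next
    case (mult f g)
    have "bsubst c (f * g) - f * g = bsubst c f * (bsubst c g - g) + g * (bsubst c f - f)"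
      by (simp add: bsubst_simps algebra_simps)
    then show ?case using mult J by (simp add: ideal_add ideal_mult)
  qed
  then show ?thesis using ideal_diff_iff[OF J, of "bsubst c f" f] ideal_zero[OF J] ker by auto
qed

section \<open>Linear forms at normalised points and the primes they generate\<close>

definition lform :: "var \<Rightarrow> var \<Rightarrow> 'k \<times> 'k \<Rightarrow> 'k::comm_ring_1 bpoly" where
  "lform u v p = Const (snd p) * Var u - Const (fst p) * Var v"

abbreviation "xform \<equiv> lform X0 X1"
abbreviation "yform \<equiv> lform Y0 Y1"

text \<open>One representative for each point of the projective line, so that equality of pairs is
  equality of points.\<close>

definition normal :: "'k::field \<times> 'k \<Rightarrow> bool" where
  "normal p \<longleftrightarrow> snd p = 1 \<or> p = (1, 0)"

lemma normal_det:
  "normal p \<Longrightarrow> normal q \<Longrightarrow> snd p * fst q - fst p * snd q = 0 \<longleftrightarrow> p = q"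
  by (auto simp: normal_def prod_eq_iff)

lemma normal_other: "\<exists>p. normal p \<and> p \<noteq> q"
  by (metis fst_conv normal_def snd_conv zero_neq_one)

text \<open>The linear primes needed are sums of a part in x and a part in y: \<open>Free\<close>
  imposes nothing, \<open>Pt\<close> one linear form, \<open>Origin\<close> both variables.\<close>

datatype 'k coord = Free | Pt "'k \<times> 'k" | Origin

fun coord_ok :: "'k::field coord \<Rightarrow> bool" where
  "coord_ok (Pt p) = normal p"
| "coord_ok _ = True"

fun coord_gens :: "var \<Rightarrow> var \<Rightarrow> 'k::comm_ring_1 coord \<Rightarrow> 'k bpoly set" where
  "coord_gens u v Free = {}"
| "coord_gens u v (Pt p) = {lform u v p}"
| "coord_gens u v Origin = {Var u, Var v}"

text \<open>A parametrisation of the zero locus. Over a normal point the surviving variable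
  \<open>s\<close> is one whose coordinate is 1, so the substitution is the identity modulo the
  form.\<close>

fun coord_subst :: "var \<Rightarrow> var \<Rightarrow> 'k::comm_ring_1 coord \<Rightarrow> 'k bpoly \<times> 'k bpoly" where
  "coord_subst u v Free = (Var u, Var v)"
| "coord_subst u v (Pt p) =
     (let s = (if snd p = 1 then Var v else Var u) in (Const (fst p) * s, Const (snd p) * s))"
| "coord_subst u v Origin = (0, 0)"

definition coord_ideal :: "'k::comm_ring_1 coord \<Rightarrow> 'k coord \<Rightarrow> 'k bpoly set" where
  "coord_ideal a b = ideal_gen (coord_gens X0 X1 a \<union> coord_gens Y0 Y1 b)"

definition coord_map :: "'k::comm_ring_1 coord \<Rightarrow> 'k coord \<Rightarrow> var \<Rightarrow> 'k bpoly" where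
  "coord_map a b v = (case v of X0 \<Rightarrow> fst (coord_subst X0 X1 a) | X1 \<Rightarrow> snd (coord_subst X0 X1 a)
     | Y0 \<Rightarrow> fst (coord_subst Y0 Y1 b) | Y1 \<Rightarrow> snd (coord_subst Y0 Y1 b))"

lemma coord_map_simps [simp]:
  "coord_map a b X0 = fst (coord_subst X0 X1 a)" "coord_map a b X1 = snd (coord_subst X0 X1 a)"
  "coord_map a b Y0 = fst (coord_subst Y0 Y1 b)" "coord_map a b Y1 = snd (coord_subst Y0 Y1 b)"
  by (simp_all add: coord_map_def)

lemma is_ideal_coord_ideal: "is_ideal (coord_ideal a b)"
  by (simp add: coord_ideal_def is_ideal_ideal_gen)

lemma coord_subst_mod:
  assumes "coord_ok a" "is_ideal J" "coord_gens u v a \<subseteq> J"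
  shows "fst (coord_subst u v a) - Var u \<in> J" "snd (coord_subst u v a) - Var v \<in> J"
proof (atomize (full), cases a)
  case Free
  then show "fst (coord_subst u v a) - Var u \<in> J \<and> snd (coord_subst u v a) - Var v \<in> J"
    using ideal_zero[OF assms(2)] by simp
next
  case (Pt p)
  then have *: "lform u v p \<in> J" "normal p" using assms by auto
  have "- lform u v p \<in> J" "0 \<in> J" using * assms(2) by (auto intro: ideal_uminus ideal_zero)
  then show "fst (coord_subst u v a) - Var u \<in> J \<and> snd (coord_subst u v a) - Var v \<in> J"
    using * Pt by (auto simp: normal_def Let_def lform_def Const_zero Const_one)
next
  case Origin
  then show "fst (coord_subst u v a) - Var u \<in> J \<and> snd (coord_subst u v a) - Var v \<in> J"
    using assms ideal_uminus[OF assms(2)] by auto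
qed

lemma coord_ideal_iff:
  assumes "coord_ok a" "coord_ok b"
  shows "f \<in> coord_ideal a b \<longleftrightarrow> bsubst (coord_map a b) f = 0"
proof (rule bsubst_kernel[OF is_ideal_coord_ideal])
  have sub: "coord_gens X0 X1 a \<subseteq> coord_ideal a b" "coord_gens Y0 Y1 b \<subseteq> coord_ideal a b"
    using ideal_gen_superset unfolding coord_ideal_def by blast+
  show "coord_map a b v - Var v \<in> coord_ideal a b" for v
    using coord_subst_mod[OF assms(1) is_ideal_coord_ideal sub(1)]
      coord_subst_mod[OF assms(2) is_ideal_coord_ideal sub(2)]
    by (cases v) auto
  have "coord_ideal a b \<subseteq> bsubst (coord_map a b) -` {0}"
    unfolding coord_ideal_def
  proof (rule ideal_gen_least)
    show "is_ideal (bsubst (coord_map a b) -` {0})"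
      by (rule is_ideal_vimage[OF is_hom_bsubst is_ideal_zero])
    show "coord_gens X0 X1 a \<union> coord_gens Y0 Y1 b \<subseteq> bsubst (coord_map a b) -` {0}"
      by (cases a; cases b)
        (simp_all add: lform_def bsubst_simps Let_def mult.left_commute[of "Const (fst _)"] del: if_split)
  qed
  then show "bsubst (coord_map a b) f = 0" if "f \<in> coord_ideal a b" for f using that by blast
qed

lemma prime_coord_ideal:
  assumes "coord_ok a" "coord_ok (b :: 'k::field coord)" shows "prime_ideal (coord_ideal a b)"
proof -
  have "1 \<notin> coord_ideal a b" by (simp add: coord_ideal_iff[OF assms] bsubst_simps)
  then have "coord_ideal a b \<noteq> UNIV" by blast
  then show ?thesis
    using is_ideal_coord_ideal[of a b]
    by (auto simp: prime_ideal_def coord_ideal_iff[OF assms] bsubst_simps)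
qed

lemma xform_mem_coord_ideal:
  fixes p :: "'k::field \<times> 'k"
  assumes "coord_ok a" "coord_ok b" "normal p"
  shows "xform p \<in> coord_ideal a b \<longleftrightarrow> (case a of Free \<Rightarrow> False | Pt q \<Rightarrow> p = q | Origin \<Rightarrow> True)"
proof (cases a)
  case Free
  have "xform p \<noteq> 0"
  proof
    assume "xform p = 0"
    then have *: "bsubst c (xform p) = 0" for c by (simp add: bsubst_simps)
    show False using *[of "\<lambda>v. if v = X0 then 1 else 0"] *[of "\<lambda>v. if v = X1 then 1 else 0"] assms(3)
      by (auto simp: lform_def bsubst_simps normal_def Const_eq_0_iff)
  qed
  moreover have "bsubst (coord_map Free b) (xform p) = xform p"
    by (simp add: lform_def bsubst_simps)
  ultimately show ?thesis using coord_ideal_iff[OF assms(1,2)] Free by simp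
next
  case (Pt q)
  let ?s = "if snd q = 1 then Var X1 else Var X0"
  have "bsubst (coord_map (Pt q) b) (xform p) = Const (snd p * fst q - fst p * snd q) * ?s"
    by (simp add: lform_def bsubst_simps Let_def Const_diff Const_mult algebra_simps)
  moreover have "Const e * ?s = 0 \<longleftrightarrow> e = 0" for e :: 'k
    by (simp add: Const_eq_0_iff Var_neq_0)
  ultimately show ?thesis
    using coord_ideal_iff[OF assms(1,2)] Pt assms normal_det[of p q] by simp
next
  case Origin
  then show ?thesis using coord_ideal_iff[OF assms(1,2)] by (simp add: lform_def bsubst_simps)
qed

lemma yform_mem_coord_ideal:
  fixes p :: "'k::field \<times> 'k"
  assumes "coord_ok a" "coord_ok b" "normal p"
  shows "yform p \<in> coord_ideal a b \<longleftrightarrow> (case b of Free \<Rightarrow> False | Pt q \<Rightarrow> p = q | Origin \<Rightarrow> True)"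
proof (cases b)
  case Free
  have "yform p \<noteq> 0"
  proof
    assume "yform p = 0"
    then have *: "bsubst c (yform p) = 0" for c by (simp add: bsubst_simps)
    show False using *[of "\<lambda>v. if v = Y0 then 1 else 0"] *[of "\<lambda>v. if v = Y1 then 1 else 0"] assms(3)
      by (auto simp: lform_def bsubst_simps normal_def Const_eq_0_iff)
  qed
  moreover have "bsubst (coord_map a Free) (yform p) = yform p"
    by (simp add: lform_def bsubst_simps)
  ultimately show ?thesis using coord_ideal_iff[OF assms(1,2)] Free by simp
next
  case (Pt q)
  let ?s = "if snd q = 1 then Var Y1 else Var Y0"
  have "bsubst (coord_map a (Pt q)) (yform p) = Const (snd p * fst q - fst p * snd q) * ?s"
    by (simp add: lform_def bsubst_simps Let_def Const_diff Const_mult algebra_simps)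
  moreover have "Const e * ?s = 0 \<longleftrightarrow> e = 0" for e :: 'k
    by (simp add: Const_eq_0_iff Var_neq_0)
  ultimately show ?thesis
    using coord_ideal_iff[OF assms(1,2)] Pt assms normal_det[of p q] by simp
next
  case Origin
  then show ?thesis using coord_ideal_iff[OF assms(1,2)] by (simp add: lform_def bsubst_simps)
qed

lemma nzd_xform:
  assumes "coord_ok a" "coord_ok b" "normal p" "case a of Free \<Rightarrow> True | Pt q \<Rightarrow> p \<noteq> q | Origin \<Rightarrow> False"
  shows "nzd (coord_ideal a b) (xform p)"
  using assms xform_mem_coord_ideal[OF assms(1-3)]
  by (intro nzd_prime prime_coord_ideal) (auto split: coord.splits)

lemma nzd_yform:
  assumes "coord_ok a" "coord_ok b" "normal p" "case b of Free \<Rightarrow> True | Pt q \<Rightarrow> p \<noteq> q | Origin \<Rightarrow> False"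
  shows "nzd (coord_ideal a b) (yform p)"
  using assms yform_mem_coord_ideal[OF assms(1-3)]
  by (intro nzd_prime prime_coord_ideal) (auto split: coord.splits)

text \<open>Cramer's rule; the determinant of two distinct normal pairs is invertible. The factor
  \<open>w\<close> makes the rule apply to candidate socle elements.\<close>

lemma two_forms_kill_variables:
  assumes J: "is_ideal J" and n: "normal p" "normal q" "p \<noteq> q"
    and "lform u v p * w \<in> J" "lform u v q * w \<in> J"
  shows "Var u * w \<in> J" "Var v * w \<in> J"
proof -
  define d where "d = snd p * fst q - fst p * snd q"
  have d: "Const (inverse d) * Const d = 1"
    using normal_det[OF n(1,2)] n(3) by (simp add: d_def Const_one flip: Const_mult)
  have "Const (inverse d) * (Const (fst q) * (lform u v p * w) - Const (fst p) * (lform u v q * w)) \<in> J"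
    by (rule ideal_mult[OF J ideal_diff[OF J ideal_mult[OF J assms(5)] ideal_mult[OF J assms(6)]]])
  moreover have "Const (fst q) * (lform u v p * w) - Const (fst p) * (lform u v q * w) = Const d * (Var u * w)"
    by (simp add: lform_def d_def Const_diff Const_mult algebra_simps)
  ultimately show "Var u * w \<in> J" using d by (metis mult.assoc mult_1)
  have "Const (inverse d) * (Const (snd q) * (lform u v p * w) - Const (snd p) * (lform u v q * w)) \<in> J"
    by (rule ideal_mult[OF J ideal_diff[OF J ideal_mult[OF J assms(5)] ideal_mult[OF J assms(6)]]])
  moreover have "Const (snd q) * (lform u v p * w) - Const (snd p) * (lform u v q * w) = Const d * (Var v * w)"
    by (simp add: lform_def d_def Const_diff Const_mult algebra_simps)
  ultimately show "Var v * w \<in> J" using d by (metis mult.assoc mult_1)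
qed

lemma lform_mem_variables:
  "is_ideal J \<Longrightarrow> Var u \<in> J \<Longrightarrow> Var v \<in> J \<Longrightarrow> lform u v p \<in> J"
  by (simp add: lform_def ideal_diff ideal_mult)

lemma ideal_gen_two_forms:
  assumes n: "normal p" "normal q" "p \<noteq> q"
  shows "ideal_gen (insert (lform u v p) (insert (lform u v q) G)) = ideal_gen (insert (Var u) (insert (Var v) G))"
proof (rule ideal_gen_eqI)
  let ?J = "ideal_gen (insert (lform u v p) (insert (lform u v q) G))"
  have "lform u v p \<in> ?J" "lform u v q \<in> ?J" "G \<subseteq> ?J"
    using ideal_gen_superset[of "insert (lform u v p) (insert (lform u v q) G)"] by auto
  then show "insert (Var u) (insert (Var v) G) \<subseteq> ?J"
    using two_forms_kill_variables[OF is_ideal_ideal_gen n, of u v 1] by (simp only: mult_1_right insert_subset)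
  let ?J = "ideal_gen (insert (Var u) (insert (Var v) G))"
  have "Var u \<in> ?J" "Var v \<in> ?J" "G \<subseteq> ?J"
    using ideal_gen_superset[of "insert (Var u) (insert (Var v) G)"] by auto
  then show "insert (lform u v p) (insert (lform u v q) G) \<subseteq> ?J"
    by (auto intro!: lform_mem_variables[OF is_ideal_ideal_gen])
qed

lemma coord_ideal_Free: "coord_ideal Free Free = {0}"
  by (simp add: coord_ideal_def ideal_gen_empty)

text \<open>A new linear form turns \<open>Free\<close> into \<open>Pt\<close> and, at a different
  point, \<open>Pt\<close> into \<open>Origin\<close>, so successive quotients stay among the linear
  primes.\<close>

lemma adjoin_coord_ideal:
  "adjoin (coord_ideal Free b) (xform p) = coord_ideal (Pt p) b"
  "adjoin (coord_ideal a Free) (yform p) = coord_ideal a (Pt p)"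
  "normal p \<Longrightarrow> normal q \<Longrightarrow> p \<noteq> q \<Longrightarrow> adjoin (coord_ideal (Pt q) b) (xform p) = coord_ideal Origin b"
  "normal p \<Longrightarrow> normal q \<Longrightarrow> p \<noteq> q \<Longrightarrow> adjoin (coord_ideal a (Pt q)) (yform p) = coord_ideal a Origin"
  unfolding coord_ideal_def ideal_gen_insert[symmetric]
  by (simp_all add: ideal_gen_two_forms)

lemma coord_ideal_point: "coord_ideal (Pt p) (Pt q) = point_ideal (p, q)"
  by (cases p; cases q) (simp add: coord_ideal_def point_ideal_def lform_def insert_commute)

lemma coord_ideal_Origin: "coord_ideal Origin Origin = irrelevant_ideal"
  by (simp add: coord_ideal_def irrelevant_ideal_list insert_commute)

section \<open>Dimension\<close>

text \<open>Modulo a point ideal, each pair of variables reduces to multiples of a single one, so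
  two indeterminates reach all residue classes. Surjectivity keeps chains of primes strict under
  pullback.\<close>

lemma poly_poly_residues:
  fixes p q :: "'k::field \<times> 'k"
  assumes n: "normal p" "normal q"
  shows "\<exists>\<psi> :: 'k poly poly \<Rightarrow> 'k bpoly. is_hom \<psi> \<and> (\<forall>f. \<exists>g. f - \<psi> g \<in> coord_ideal (Pt p) (Pt q))"
proof -
  define s t :: "'k bpoly" where "s = (if snd p = 1 then Var X1 else Var X0)"
    and "t = (if snd q = 1 then Var Y1 else Var Y0)"
  define \<psi>0 where "\<psi>0 a = poly (map_poly Const a) s" for a
  define \<psi> where "\<psi> g = poly (map_poly \<psi>0 g) t" for g
  have "is_hom \<psi>0" unfolding \<psi>0_def by (rule is_hom_poly[OF is_hom_Const])
  then have hom: "is_hom \<psi>" unfolding \<psi>_def by (rule is_hom_poly)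
  have \<psi>0: "\<psi>0 [:c:] = Const c" "\<psi>0 [:0, c:] = Const c * s" "\<psi>0 0 = 0" for c
    by (simp_all add: \<psi>0_def map_poly_pCons Const_zero mult.commute)
  have \<psi>: "\<psi> [:a:] = \<psi>0 a" "\<psi> [:0, a:] = \<psi>0 a * t" for a
    by (simp_all add: \<psi>_def map_poly_pCons \<psi>0 mult.commute)
  let ?J = "coord_ideal (Pt p) (Pt q)"
  note J = is_ideal_coord_ideal[of "Pt p" "Pt q"]
  have "\<exists>g. f - \<psi> g \<in> ?J" for f
  proof (induction f rule: bpoly_induct)
    case (Const c)
    have "Const c - \<psi> [:[:c:]:] \<in> ?J" using ideal_zero[OF J] by (simp add: \<psi> \<psi>0)
    then show ?case ..
  next
    case (Var v)
    have gens: "xform p \<in> ?J" "yform q \<in> ?J" using n by (auto simp: xform_mem_coord_ideal yform_mem_coord_ideal)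
    have "Var X0 - \<psi> [:[:0, fst p:]:] \<in> ?J" "Var X1 - \<psi> [:[:0, snd p:]:] \<in> ?J"
      "Var Y0 - \<psi> [:0, [:fst q:]:] \<in> ?J" "Var Y1 - \<psi> [:0, [:snd q:]:] \<in> ?J"
      using n gens ideal_zero[OF J] ideal_uminus[OF J gens(1)] ideal_uminus[OF J gens(2)]
      by (auto simp: \<psi> \<psi>0 s_def t_def normal_def lform_def Const_one Const_zero)
    then show ?case by (cases v) blast+
  next
    case (add f g)
    then obtain a b where "f - \<psi> a \<in> ?J" "g - \<psi> b \<in> ?J" by blast
    then have "(f - \<psi> a) + (g - \<psi> b) \<in> ?J" by (rule ideal_add[OF J])
    then have "f + g - \<psi> (a + b) \<in> ?J" by (simp add: is_homD[OF hom] algebra_simps)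
    then show ?case ..
  next
    case (mult f g)
    then obtain a b where "f - \<psi> a \<in> ?J" "g - \<psi> b \<in> ?J" by blast
    then have "g * (f - \<psi> a) + \<psi> a * (g - \<psi> b) \<in> ?J" by (simp add: ideal_add ideal_mult J)
    then have "f * g - \<psi> (a * b) \<in> ?J" by (simp add: is_homD[OF hom] algebra_simps)
    then show ?case ..
  qed
  with hom show ?thesis by blast
qed

lemma krull_dim_quot_le_two:
  fixes I :: "'k::alg_closed_field bpoly set"
  assumes "\<And>P. prime_ideal P \<Longrightarrow> I \<subseteq> P \<Longrightarrow> \<exists>p q. normal p \<and> normal q \<and> coord_ideal (Pt p) (Pt q) \<subseteq> P"
  shows "krull_dim_quot I \<le> 2"
  unfolding krull_dim_quot_def
proof (rule Sup_least, clarify)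
  fix n and P :: "nat \<Rightarrow> 'k bpoly set"
  assume P: "\<forall>i\<le>n. prime_ideal (P i) \<and> I \<subseteq> P i" and chain: "\<forall>i<n. P i \<subset> P (Suc i)"
  have "n \<le> 2"
  proof (rule ccontr)
    assume "\<not> n \<le> 2"
    then have lt: "P 0 \<subset> P 1" "P 1 \<subset> P 2" "P 2 \<subset> P 3"
      and pr: "prime_ideal (P 0)" "I \<subseteq> P 0" "prime_ideal (P 1)" "prime_ideal (P 2)" "prime_ideal (P 3)"
      using P chain by (auto simp: numeral_2_eq_2 numeral_3_eq_3)
    obtain p q where pq: "normal p" "normal q" "coord_ideal (Pt p) (Pt q) \<subseteq> P 0"
      using assms pr by blast
    obtain \<psi> :: "'k poly poly \<Rightarrow> 'k bpoly" where \<psi>: "is_hom \<psi>"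
      "\<And>f. \<exists>g. f - \<psi> g \<in> coord_ideal (Pt p) (Pt q)"
      using poly_poly_residues[OF pq(1,2)] by blast
    have strict: "\<psi> -` P' \<subset> \<psi> -` P''"
      if lt': "P' \<subset> P''" and pr': "prime_ideal P'" "prime_ideal P''" and "P 0 \<subseteq> P'" for P' P''
    proof -
      obtain f where f: "f \<in> P''" "f \<notin> P'" using \<open>P' \<subset> P''\<close> by blast
      obtain g where "f - \<psi> g \<in> P'" using \<psi>(2)[of f] pq(3) \<open>P 0 \<subseteq> P'\<close> by blast
      then have "\<psi> g \<in> P''" "\<psi> g \<notin> P'"
        using f lt' ideal_diff_iff[OF prime_ideal_is_ideal[OF pr'(1)]]
          ideal_diff_iff[OF prime_ideal_is_ideal[OF pr'(2)]] by blast+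
      then show ?thesis using lt' by blast
    qed
    have s: "\<psi> -` P 0 \<subset> \<psi> -` P 1" "\<psi> -` P 1 \<subset> \<psi> -` P 2" "\<psi> -` P 2 \<subset> \<psi> -` P 3"
      using strict[OF lt(1) pr(1,3)] strict[OF lt(2) pr(3,4)] strict[OF lt(3) pr(4,5)] lt by auto
    \<comment> \<open>The pullback of \<open>P 1\<close> is strictly larger than an ideal, hence has
      the nonzero element that \<open>prime_chain_poly_poly\<close> asks for.\<close>
    have "0 \<in> \<psi> -` P 0"
      using ideal_zero[OF prime_ideal_is_ideal[OF prime_ideal_vimage[OF \<psi>(1) pr(1)]]] .
    with s(1) obtain f where "f \<in> \<psi> -` P 1" "f \<noteq> 0" by blast
    then show False
      using prime_chain_poly_poly[OF prime_ideal_vimage[OF \<psi>(1) pr(3)] prime_ideal_vimage[OF \<psi>(1) pr(4)]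
          prime_ideal_vimage[OF \<psi>(1) pr(5)] s(2,3)] by blast
  qed
  then show "enat n \<le> 2" by (simp add: numeral_eq_enat)
qed

lemma krull_dim_quot_ge_two:
  fixes I :: "'k::field bpoly set"
  assumes n: "normal p" "normal q" and I: "I \<subseteq> coord_ideal (Pt p) (Pt q)"
  shows "krull_dim_quot I \<ge> 2"
proof -
  define P where "P i = (if i = 0 then coord_ideal (Pt p) (Pt q) else if i = 1 then coord_ideal (Pt p) Origin
     else coord_ideal Origin Origin)" for i :: nat
  obtain p' q' where n': "normal p'" "normal q'" "p' \<noteq> p" "q' \<noteq> q" by (metis normal_other)
  have "adjoin (coord_ideal (Pt p) (Pt q)) (yform q') = coord_ideal (Pt p) Origin"
    and "adjoin (coord_ideal (Pt p) Origin) (xform p') = coord_ideal Origin Origin"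
    using n n' adjoin_coord_ideal by blast+
  then have sub: "coord_ideal (Pt p) (Pt q) \<subseteq> coord_ideal (Pt p) Origin"
     "coord_ideal (Pt p) Origin \<subseteq> coord_ideal Origin Origin"
    using adjoin_superset by blast+
  have "yform q' \<in> coord_ideal (Pt p) Origin - coord_ideal (Pt p) (Pt q)"
    "xform p' \<in> coord_ideal Origin Origin - coord_ideal (Pt p) Origin"
    using n n' by (auto simp: xform_mem_coord_ideal yform_mem_coord_ideal)
  then have "P 0 \<subset> P 1" "P 1 \<subset> P 2" using sub by (auto simp: P_def)
  then have "\<forall>i<2. P i \<subset> P (Suc i)" by (simp add: numeral_2_eq_2 All_less_Suc)
  moreover have "\<forall>i\<le>2. prime_ideal (P i) \<and> I \<subseteq> P i"
    using I sub n by (auto simp: P_def intro!: prime_coord_ideal)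
  ultimately have "enat 2 \<le> krull_dim_quot I"
    unfolding krull_dim_quot_def by (intro Sup_upper) blast
  then show ?thesis by (simp add: numeral_eq_enat)
qed

section \<open>Fat points with normalised coordinates\<close>

definition normal_set :: "'k::field point set \<Rightarrow> bool" where
  "normal_set S \<longleftrightarrow> (\<forall>P\<in>S. normal (fst P) \<and> normal (snd P))"

lemma fat_ideal_eq: "fat_ideal m S = (\<Inter>P\<in>S. pair_pow {0} (xform (fst P)) (yform (snd P)) m)"
  unfolding fat_ideal_def ideal_pow_pair[symmetric]
  by (rule INF_cong) (auto simp: point_ideal_def lform_def split: prod.splits)

lemma is_ideal_fat_ideal: "is_ideal (fat_ideal m S)"
  unfolding fat_ideal_eq by (intro is_ideal_INT is_ideal_pair_pow is_ideal_zero)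

lemma point_ideal_eq: "point_ideal P = coord_ideal (Pt (fst P)) (Pt (snd P))"
  by (simp add: coord_ideal_point)

lemma pair_pow_one: "pair_pow {0} u v (Suc 0) = ideal_gen {u, v}"
  using ideal_gen_insert[of v "{u}"]
  by (auto simp: ideal_gen_singleton insert_commute adjoin_def)

lemma points_ideal_eq: "points_ideal S = fat_ideal (Suc 0) S"
  unfolding points_ideal_def fat_ideal_eq pair_pow_one
  by (rule INF_cong) (auto simp: point_ideal_def lform_def split: prod.splits)

lemma fat_ideal_subset_point_ideal:
  assumes "P \<in> S" "m > 0" shows "fat_ideal m S \<subseteq> point_ideal P"
proof -
  obtain k where k: "m = Suc k" using assms by (cases m) auto
  have "pair_pow {0} (xform (fst P)) (yform (snd P)) (Suc k) \<subseteq> point_ideal P"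
  proof -
    have "xform (fst P) \<in> point_ideal P" "yform (snd P) \<in> point_ideal P"
      using ideal_gen_superset by (auto simp: point_ideal_eq coord_ideal_def intro!: subsetD[OF ideal_gen_superset])
    then show ?thesis
      using is_ideal_coord_ideal[of "Pt (fst P)" "Pt (snd P)"]
      by (auto simp: point_ideal_eq elim!: pair_powE intro!: ideal_add ideal_mult_right)
  qed
  then show ?thesis using assms k by (auto simp: fat_ideal_eq)
qed

lemma krull_dim_fat_ideal_ge:
  assumes "S \<noteq> {}" "normal_set S" "m > 0" shows "krull_dim_quot (fat_ideal m S) \<ge> 2"
proof -
  obtain P where "P \<in> S" using assms by blast
  then show ?thesis
    using assms fat_ideal_subset_point_ideal[of P S m] krull_dim_quot_ge_two[of "fst P" "snd P"]
    by (simp add: normal_set_def point_ideal_eq)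
qed

lemma power_mem_ideal_pow: "f \<in> I \<Longrightarrow> f ^ n \<in> ideal_pow I n"
proof (induction n)
  case (Suc n)
  then show ?case by (auto simp: ideal_prod_def intro!: subsetD[OF ideal_gen_superset])
qed simp

text \<open>If a prime missed an element \<open>f Q\<close> of each point ideal, the product of
  their m-th powers would lie in the fat ideal but outside the prime. So every prime over the fat
  ideal contains a point ideal.\<close>

lemma krull_dim_fat_ideal:
  fixes S :: "'k::alg_closed_field point set"
  assumes S: "finite S" "S \<noteq> {}" "normal_set S" and m: "m > 0"
  shows "krull_dim_quot (fat_ideal m S) = 2"
proof (rule antisym[OF krull_dim_quot_le_two krull_dim_fat_ideal_ge[OF S(2,3) m]])
  fix P assume P: "prime_ideal P" "fat_ideal m S \<subseteq> P"
  have "\<exists>Q\<in>S. point_ideal Q \<subseteq> P"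
  proof (rule ccontr)
    assume "\<not> (\<exists>Q\<in>S. point_ideal Q \<subseteq> P)"
    then have "\<forall>Q\<in>S. \<exists>f. f \<in> point_ideal Q \<and> f \<notin> P" by blast
    then obtain f where f: "\<And>Q. Q \<in> S \<Longrightarrow> f Q \<in> point_ideal Q" "\<And>Q. Q \<in> S \<Longrightarrow> f Q \<notin> P" by metis
    have "(\<Prod>Q\<in>S. f Q ^ m) \<in> fat_ideal m S"
      unfolding fat_ideal_def
    proof
      fix Q assume Q: "Q \<in> S"
      have "is_ideal (ideal_pow (point_ideal Q) m)"
        by (cases m) (auto simp: is_ideal_UNIV ideal_prod_def is_ideal_ideal_gen)
      then show "(\<Prod>Q\<in>S. f Q ^ m) \<in> ideal_pow (point_ideal Q) m"
        using S(1) Q by (rule ideal_prod_mem) (rule power_mem_ideal_pow[OF f(1)[OF Q]])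
    qed
    then obtain Q where "Q \<in> S" "f Q ^ m \<in> P" using prime_ideal_prod[OF P(1) S(1)] P(2) by blast
    then show False using f(2) prime_ideal_power[OF P(1)] by blast
  qed
  then show "\<exists>p q. normal p \<and> normal q \<and> coord_ideal (Pt p) (Pt q) \<subseteq> P"
    using S(3) unfolding normal_set_def point_ideal_eq by blast
qed

text \<open>Over a finite field the product of all X - a, plus 1, is nonconstant without a
  root.\<close>

lemma infinite_alg_closed_field: "infinite (UNIV :: 'k::alg_closed_field set)"
proof
  assume fin: "finite (UNIV :: 'k set)"
  define p :: "'k poly" where "p = (\<Prod>a\<in>UNIV. [:- a, 1:])"
  have "degree p = card (UNIV :: 'k set)"
    unfolding p_def by (subst degree_prod_eq_sum_degree) auto
  then have "degree (p + 1) > 0"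
    using fin finite_UNIV_card_ge_0[OF fin] by (subst degree_add_eq_left) auto
  then obtain x where "poly (p + 1) x = 0" using alg_closed_imp_poly_has_root by blast
  moreover have "poly p x = 0" using fin by (auto simp: p_def poly_prod)
  ultimately show False by simp
qed

lemma ex_normal_avoiding:
  assumes "finite (A :: ('k::alg_closed_field \<times> 'k) set)" shows "\<exists>c. (c, 1) \<notin> A"
proof -
  have "infinite (range (\<lambda>c :: 'k. (c, 1 :: 'k)))"
    using infinite_alg_closed_field[where 'k = 'k] by (subst finite_image_iff) (auto simp: inj_on_def)
  then have "\<not> range (\<lambda>c :: 'k. (c, 1 :: 'k)) \<subseteq> A" using assms finite_subset by blast
  then show ?thesis by blast
qed

lemma nzd_fat_ideal_xform:
  assumes "normal_set S" "normal c" "c \<notin> fst ` S"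
  shows "nzd (fat_ideal m S) (xform c)"
  unfolding fat_ideal_eq
proof (intro nzd_INT nzd_pair_pow is_ideal_zero)
  fix P assume P: "P \<in> S"
  then have *: "normal (fst P)" "normal (snd P)" "c \<noteq> fst P" using assms by (auto simp: normal_set_def)
  show "nzd {0} (xform (fst P))" "nzd (adjoin {0} (xform (fst P))) (yform (snd P))"
    "nzd (adjoin (adjoin {0} (xform (fst P))) (yform (snd P))) (xform c)"
    unfolding coord_ideal_Free[symmetric] adjoin_coord_ideal
    using * assms(2) by (auto intro!: nzd_xform nzd_yform)
qed

lemma has_socle_irrelevantI:
  assumes J: "is_ideal J" and "w \<notin> J" "\<And>v. Var v * w \<in> J"
  shows "has_socle irrelevant_ideal J"
proof -
  have "irrelevant_ideal \<subseteq> {a. a * w \<in> J}"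
    unfolding irrelevant_ideal_def using assms
    by (intro ideal_gen_least) (auto simp: is_ideal_def algebra_simps)
  then show ?thesis using assms(2) by (auto simp: has_socle_def)
qed

lemma lform_irrelevant: "lform u v p \<in> irrelevant_ideal"
  using ideal_gen_superset[of "range Var"]
  by (intro lform_mem_variables) (auto simp: irrelevant_ideal_def is_ideal_ideal_gen)

section \<open>Grids\<close>

lemma nzd_xform_prod:
  assumes "coord_ok a" "coord_ok b"
    and "\<And>p. p \<in> A \<Longrightarrow> normal p \<and> (case a of Free \<Rightarrow> True | Pt c \<Rightarrow> p \<noteq> c | Origin \<Rightarrow> False)"
  shows "nzd (coord_ideal a b) (\<Prod>p\<in>A. xform p)"
  using assms by (intro nzd_prod nzd_xform) auto

text \<open>A product of x-forms need not generate a prime. In the reversed order the y-form comes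
  first, the base is again a linear prime, and each x-form is tested there.\<close>

lemma nzd_adjoin_xform_prod_yform:
  assumes a: "coord_ok a" "coord_ok b"
    and A: "\<And>p. p \<in> A \<Longrightarrow> normal p \<and> (case a of Free \<Rightarrow> True | Pt c \<Rightarrow> p \<noteq> c | Origin \<Rightarrow> False)"
    and q: "normal q" "case b of Free \<Rightarrow> True | Pt c \<Rightarrow> q \<noteq> c | Origin \<Rightarrow> False"
  shows "nzd (adjoin (coord_ideal a b) (\<Prod>p\<in>A. xform p)) (yform q)"
proof (rule nzd_adjoin_swap[OF is_ideal_coord_ideal nzd_yform[OF a q]])
  obtain b' where "coord_ok b'" "adjoin (coord_ideal a b) (yform q) = coord_ideal a b'"
    using q a by (cases b) (auto simp: adjoin_coord_ideal intro: that[of "Pt q"] that[of Origin])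
  then show "nzd (adjoin (coord_ideal a b) (yform q)) (\<Prod>p\<in>A. xform p)"
    using nzd_xform_prod[OF a(1) _ A] by simp
qed

text \<open>\<open>pair_pow_INT\<close> is used twice with the generators exchanged: within one row
  it multiplies the column forms, and then it multiplies the row forms.\<close>

lemma fat_ideal_grid:
  assumes fin: "finite A" "finite B" and n: "\<And>p. p \<in> A \<Longrightarrow> normal p" "\<And>q. q \<in> B \<Longrightarrow> normal q"
  shows "fat_ideal m (A \<times> B) = pair_pow {0} (\<Prod>p\<in>A. xform p) (\<Prod>q\<in>B. yform q) m" (is "_ = pair_pow _ ?F ?G _")
proof (rule set_eqI, rule iffI)
  fix f assume f: "f \<in> fat_ideal m (A \<times> B)"
  show "f \<in> pair_pow {0} ?F ?G m"
  proof (rule pair_pow_INT[OF is_ideal_zero fin(2)])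
    show "nzd {0} ?F"
      unfolding coord_ideal_Free[symmetric] using n by (intro nzd_xform_prod) auto
    show "nzd (adjoin {0} ?F) (yform q)" if "q \<in> B" for q
      unfolding coord_ideal_Free[symmetric] using n that by (intro nzd_adjoin_xform_prod_yform) auto
    show "nzd (adjoin (adjoin {0} ?F) (yform p)) (yform q)" if "q \<in> B" "p \<in> B" "q \<noteq> p" for p q
      unfolding coord_ideal_Free[symmetric] adjoin_commute[OF is_ideal_coord_ideal, of Free Free ?F] adjoin_coord_ideal
      using n that by (intro nzd_adjoin_xform_prod_yform) auto
    fix q assume q: "q \<in> B"
    have "f \<in> pair_pow {0} (yform q) ?F m"
    proof (rule pair_pow_INT[OF is_ideal_zero fin(1)])
      show "nzd {0} (yform q)" "\<And>p. p \<in> A \<Longrightarrow> nzd (adjoin {0} (yform q)) (xform p)"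
        "\<And>p r. p \<in> A \<Longrightarrow> r \<in> A \<Longrightarrow> p \<noteq> r \<Longrightarrow> nzd (adjoin (adjoin {0} (yform q)) (xform r)) (xform p)"
        unfolding coord_ideal_Free[symmetric] adjoin_coord_ideal
        using n q by (simp_all add: nzd_xform nzd_yform)
      show "f \<in> pair_pow {0} (yform q) (xform p) m" if "p \<in> A" for p
        using f q that pair_pow_commute[of "yform q" "xform p" m] by (auto simp: fat_ideal_eq)
    qed
    then show "f \<in> pair_pow {0} ?F (yform q) m" by (simp add: pair_pow_commute)
  qed
next
  fix f assume f: "f \<in> pair_pow {0} ?F ?G m"
  have "f \<in> pair_pow {0} (xform p) (yform q) m" if "p \<in> A" "q \<in> B" for p q
  proof -
    have "?F = xform p * (\<Prod>p\<in>A-{p}. xform p)" "?G = yform q * (\<Prod>q\<in>B-{q}. yform q)"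
      using fin that by (simp_all add: prod.remove)
    then have "f \<in> pair_pow {0} (yform q) ?F m"
      using f pair_pow_mono_right[OF is_ideal_zero, of ?F "yform q"] pair_pow_commute[of ?F "yform q"] by auto
    then show ?thesis
      using pair_pow_mono_right[OF is_ideal_zero, of "yform q" "xform p"] pair_pow_commute[of "yform q"]
        \<open>?F = xform p * _\<close> by auto
  qed
  then show "f \<in> fat_ideal m (A \<times> B)" by (auto simp: fat_ideal_eq)
qed

lemma depth_fat_ideal_grid:
  fixes A B :: "('k::alg_closed_field \<times> 'k) set"
  assumes fin: "finite A" "finite B" and ne: "A \<noteq> {}" "B \<noteq> {}" and m: "m > 0"
    and n: "\<And>p. p \<in> A \<Longrightarrow> normal p" "\<And>q. q \<in> B \<Longrightarrow> normal q"
  shows "depth_quot (fat_ideal m (A \<times> B)) = 2"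
proof -
  let ?F = "\<Prod>p\<in>A. xform p" and ?G = "\<Prod>q\<in>B. yform q"
  let ?I = "fat_ideal m (A \<times> B)"
  obtain c' d' where cd': "(c', 1) \<notin> A" "(d', 1) \<notin> B" using ex_normal_avoiding fin by metis
  define c d where "c = (c', 1 :: 'k)" and "d = (d', 1 :: 'k)"
  have cd: "normal c" "normal d" "c \<notin> A" "d \<notin> B" using cd' by (auto simp: c_def d_def normal_def)
  note I = is_ideal_fat_ideal[of m "A \<times> B"]
  have S: "normal_set (A \<times> B)" using n by (auto simp: normal_set_def)
  let ?J0 = "coord_ideal (Pt c) Free"
  have base: "adjoin ?I (xform c) = pair_pow ?J0 ?F ?G m"
    using adjoin_coord_ideal(1)[of Free c]
    by (simp add: fat_ideal_grid[OF fin n] adjoin_pair_pow[OF is_ideal_zero] coord_ideal_Free)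
  have A: "normal p \<and> (case Pt c of Free \<Rightarrow> True | Pt c \<Rightarrow> p \<noteq> c | Origin \<Rightarrow> False)" if "p \<in> A" for p
    using n that cd by auto
  \<comment> \<open>Modulo \<open>xform c\<close> the ideal is still a power of one generated by a
    regular sequence, so \<open>yform d\<close> need only be tested modulo \<open>?F\<close> and
    \<open>?G\<close>.\<close>
  have regular: "nzd (adjoin ?I (xform c)) (yform d)"
    unfolding base
  proof (rule nzd_pair_pow[OF is_ideal_coord_ideal])
    show "nzd ?J0 ?F" using cd by (intro nzd_xform_prod A) auto
    show "nzd (adjoin ?J0 ?F) ?G" using n cd by (intro nzd_prod nzd_adjoin_xform_prod_yform A) auto
    show "nzd (adjoin (adjoin ?J0 ?F) ?G) (yform d)"
    proof (rule nzd_adjoin_swap[OF is_ideal_adjoin[OF is_ideal_coord_ideal]])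
      show "nzd (adjoin ?J0 ?F) (yform d)" using cd by (intro nzd_adjoin_xform_prod_yform A) auto
      show "nzd (adjoin (adjoin ?J0 ?F) (yform d)) ?G"
        unfolding adjoin_commute[OF is_ideal_coord_ideal, of "Pt c" Free ?F] adjoin_coord_ideal
        using n cd by (intro nzd_prod nzd_adjoin_xform_prod_yform A) auto
    qed
  qed
  let ?J = "adjoin (adjoin ?I (xform c)) (yform d)"
  have J: "is_ideal ?J" by (intro is_ideal_adjoin I)
  have IJ: "?I \<subseteq> ?J" using adjoin_superset by blast
  obtain p q where "p \<in> A" "q \<in> B" using ne by blast
  then have "?I \<subseteq> irrelevant_ideal"
    using fat_ideal_subset_point_ideal[of "(p, q)" "A \<times> B" m] m
      lform_irrelevant[of X0 X1 p] lform_irrelevant[of Y0 Y1 q]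
      ideal_gen_least[of irrelevant_ideal "{xform p, yform q}"]
    by (auto simp: point_ideal_eq coord_ideal_def insert_commute irrelevant_ideal_def is_ideal_ideal_gen)
  then have "?J \<subseteq> irrelevant_ideal"
    by (intro adjoin_least lform_irrelevant) (auto simp: irrelevant_ideal_def is_ideal_ideal_gen)
  moreover have "(1 :: 'k bpoly) \<notin> irrelevant_ideal"
    using prime_coord_ideal[of "Origin :: 'k coord" Origin] ideal_eq_UNIV[of "irrelevant_ideal :: 'k bpoly set"]
    by (auto simp: prime_ideal_def coord_ideal_Origin)
  ultimately have "1 \<notin> ?J" by blast
  have FG: "(\<Prod>p\<in>A. xform p ^ m) \<in> ?J" "(\<Prod>q\<in>B. yform q ^ m) \<in> ?J"
    using pair_pow_right[OF is_ideal_zero, of ?G m 1 ?F] pair_pow_right[OF is_ideal_zero, of ?F m 1 ?G] IJ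
    by (auto simp: fat_ideal_grid[OF fin n] prod_power_distrib pair_pow_commute[of ?G])
  \<comment> \<open>The start is 1, which both products send into \<open>?J\<close>. A multiple
    killed by one column form and one row form is extracted; together with \<open>xform c\<close>
    and \<open>yform d\<close> these kill all four variables.\<close>
  obtain p r where p: "p \<in> A" "r \<notin> ?J" "xform p * r \<in> ?J"
    using killed_by_prod_factor[OF J fin(1), of xform "\<lambda>_. m" 1] FG(1) \<open>1 \<notin> ?J\<close> by auto
  obtain q s where q: "q \<in> B" "s * r \<notin> ?J" "yform q * (s * r) \<in> ?J"
    using killed_by_prod_factor[OF J fin(2), of yform "\<lambda>_. m" r] ideal_mult_right[OF J FG(2)] p(2) by blast
  have "xform p * (s * r) \<in> ?J" using ideal_mult[OF J p(3), of s] by (simp add: ac_simps)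
  moreover have "xform c * (s * r) \<in> ?J" "yform d * (s * r) \<in> ?J"
    using adjoin_self[OF I] adjoin_superset adjoin_self[OF is_ideal_adjoin[OF I]]
    by (blast intro: ideal_mult_right[OF J])+
  ultimately have "Var v * (s * r) \<in> ?J" for v
    using two_forms_kill_variables[OF J n(1)[OF p(1)] cd(1), of X0 X1 "s * r"]
      two_forms_kill_variables[OF J n(2)[OF q(1)] cd(2), of Y0 Y1 "s * r"] p q cd
    by (cases v) blast+
  then have "has_socle irrelevant_ideal ?J" using has_socle_irrelevantI[OF J q(2)] by blast
  moreover have "nzd ?I (xform c)" using S cd by (intro nzd_fat_ideal_xform) auto
  ultimately show ?thesis
    using depth_quot_eq_two[OF I lform_irrelevant _ lform_irrelevant regular] by blast
qed

section \<open>Bihomogeneous components\<close>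

lemma bihomogeneous_mult:
  assumes "bihomogeneous a b f" "bihomogeneous a' b' g"
  shows "bihomogeneous (a + a') (b + b') (f * g)"
  unfolding bihomogeneous_def
proof
  fix \<mu> assume "\<mu> \<in> Poly_Mapping.keys (f * g)"
  then obtain \<nu> \<rho> where "\<mu> = \<nu> + \<rho>" "\<nu> \<in> Poly_Mapping.keys f" "\<rho> \<in> Poly_Mapping.keys g"
    using keys_mult[of f g] by blast
  then show "Poly_Mapping.lookup \<mu> X0 + Poly_Mapping.lookup \<mu> X1 = a + a' \<and>
      Poly_Mapping.lookup \<mu> Y0 + Poly_Mapping.lookup \<mu> Y1 = b + b'"
    using assms by (auto simp: bihomogeneous_def lookup_add)
qed

lemma bihomogeneous_one: "bihomogeneous 0 0 1"
  by (simp add: bihomogeneous_def)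

lemma bihomogeneous_power: "bihomogeneous a b f \<Longrightarrow> bihomogeneous (n * a) (n * b) (f ^ n)"
  by (induction n) (auto intro: bihomogeneous_one bihomogeneous_mult)

lemma bihomogeneous_prod:
  "(\<And>i. i \<in> A \<Longrightarrow> bihomogeneous (a i) (b i) (f i)) \<Longrightarrow>
    bihomogeneous (\<Sum>i\<in>A. a i) (\<Sum>i\<in>A. b i) (\<Prod>i\<in>A. f i)"
  by (induction A rule: infinite_finite_induct) (auto intro: bihomogeneous_one bihomogeneous_mult)

lemma bihomogeneous_diff:
  "bihomogeneous a b f \<Longrightarrow> bihomogeneous a b g \<Longrightarrow> bihomogeneous a b (f - g)"
  by (auto simp: bihomogeneous_def in_keys_iff lookup_minus)

lemma bihomogeneous_single:
  "bihomogeneous (Poly_Mapping.lookup \<mu> X0 + Poly_Mapping.lookup \<mu> X1)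
     (Poly_Mapping.lookup \<mu> Y0 + Poly_Mapping.lookup \<mu> Y1) (Poly_Mapping.single \<mu> c)"
  by (simp add: bihomogeneous_def)

lemma bihomogeneous_Const_Var:
  "bihomogeneous (if v = X0 \<or> v = X1 then 1 else 0) (if v = X0 \<or> v = X1 then 0 else 1) (Const c * Var v)"
  using bihomogeneous_single[of "Poly_Mapping.single v 1" c]
  by (cases v) (auto simp: Const_def Var_def mult_single lookup_single)

lemma bihomogeneous_xform: "bihomogeneous 1 0 (xform p)"
  using bihomogeneous_Const_Var[of X0 "snd p"] bihomogeneous_Const_Var[of X1 "fst p"]
  by (auto simp: lform_def intro: bihomogeneous_diff)

lemma bihomogeneous_yform: "bihomogeneous 0 1 (yform p)"
  using bihomogeneous_Const_Var[of Y0 "snd p"] bihomogeneous_Const_Var[of Y1 "fst p"]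
  by (auto simp: lform_def intro: bihomogeneous_diff)

lemma bihomogeneous_xform_power: "bihomogeneous n 0 (xform p ^ n)"
  using bihomogeneous_power[OF bihomogeneous_xform, of n p] by simp

lemma bihomogeneous_xform_prod: "bihomogeneous (\<Sum>p\<in>A. e p) 0 (\<Prod>p\<in>A. xform p ^ e p)"
  using bihomogeneous_prod[of A e "\<lambda>_. 0" "\<lambda>p. xform p ^ e p"] bihomogeneous_xform_power by auto

lemma bihomogeneous_yform_prod: "bihomogeneous 0 (card B) (\<Prod>q\<in>B. yform q)"
  using bihomogeneous_prod[of B "\<lambda>_. 0" "\<lambda>_. 1" yform] bihomogeneous_yform by auto

definition component :: "nat \<Rightarrow> nat \<Rightarrow> 'k::comm_ring_1 bpoly \<Rightarrow> 'k bpoly" where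
  "component a b f = Poly_Mapping.mapp (\<lambda>\<mu> c. if Poly_Mapping.lookup \<mu> X0 + Poly_Mapping.lookup \<mu> X1 = a
     \<and> Poly_Mapping.lookup \<mu> Y0 + Poly_Mapping.lookup \<mu> Y1 = b then c else 0) f"

lemma lookup_component:
  "Poly_Mapping.lookup (component a b f) \<mu> =
    (if Poly_Mapping.lookup \<mu> X0 + Poly_Mapping.lookup \<mu> X1 = a
     \<and> Poly_Mapping.lookup \<mu> Y0 + Poly_Mapping.lookup \<mu> Y1 = b then Poly_Mapping.lookup f \<mu> else 0)"
  by (auto simp: component_def lookup_mapp when_def in_keys_iff)

lemma component_add: "component a b (f + g) = component a b f + component a b g"
  by (rule poly_mapping_eqI) (simp add: lookup_component lookup_add)

lemma bihomogeneous_component: "bihomogeneous a b (component a b f)"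
  by (auto simp: bihomogeneous_def in_keys_iff lookup_component split: if_splits)

lemma component_bihomogeneous:
  assumes "bihomogeneous a' b' f"
  shows "component a b f = (if a = a' \<and> b = b' then f else 0)"
proof (rule poly_mapping_eqI)
  fix \<mu> show "Poly_Mapping.lookup (component a b f) \<mu> = Poly_Mapping.lookup (if a = a' \<and> b = b' then f else 0) \<mu>"
    using assms by (cases "\<mu> \<in> Poly_Mapping.keys f")
      (auto simp: lookup_component bihomogeneous_def in_keys_iff)
qed

lemma component_mult:
  assumes g: "bihomogeneous a' b' g"
  shows "component a b (g * f) = (if a' \<le> a \<and> b' \<le> b then g * component (a - a') (b - b') f else 0)"
proof (induction f rule: poly_mapping_single_induct)
  case (1 \<mu> c)
  note s = bihomogeneous_single[of \<mu> c]
  show ?case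
    using component_bihomogeneous[OF bihomogeneous_mult[OF g s], of a b]
      component_bihomogeneous[OF s, of "a - a'" "b - b'"]
    by auto
qed (auto simp: distrib_left component_add)

definition graded_ideal :: "'k::comm_ring_1 bpoly set \<Rightarrow> bool" where
  "graded_ideal J \<longleftrightarrow> (\<forall>f\<in>J. \<forall>a b. component a b f \<in> J)"

text \<open>Serves for free cofactors and, by its conditional part, for cofactors in a graded ideal;
  the zero cofactor covers components of too small a degree.\<close>

lemma component_mult_eq_mult:
  "bihomogeneous a' b' g \<Longrightarrow> \<exists>h. component a b (g * f) = g * h \<and> (f \<in> J \<longrightarrow> graded_ideal J \<longrightarrow> 0 \<in> J \<longrightarrow> h \<in> J)"
  by (subst component_mult) (auto simp: graded_ideal_def intro: exI[of _ 0])

lemma graded_pair_pow: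
  assumes "bihomogeneous a b u" "bihomogeneous c d v"
  shows "graded_ideal (pair_pow {0} u v n)"
proof (induction n)
  case (Suc n)
  show ?case unfolding graded_ideal_def
  proof (intro ballI allI)
    fix x a' b' assume "x \<in> pair_pow {0} u v (Suc n)"
    then obtain f h where x: "f \<in> pair_pow {0} u v n" "x = u * f + v ^ Suc n * h" by (auto elim: pair_powE)
    obtain f' where f': "component a' b' (u * f) = u * f'" "f' \<in> pair_pow {0} u v n"
      using component_mult_eq_mult[OF assms(1)] x(1) Suc ideal_zero[OF is_ideal_pair_pow[OF is_ideal_zero]] by blast
    obtain h' where "component a' b' (v ^ Suc n * h) = v ^ Suc n * h'"
      using component_mult_eq_mult[OF bihomogeneous_power[OF assms(2)]] by blast
    then have "component a' b' x = 0 + u * f' + v ^ Suc n * h'" by (simp only: x component_add f' add_0)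
    then show "component a' b' x \<in> pair_pow {0} u v (Suc n)" using f'(2) by (metis pair_powI singletonI)
  qed
qed (simp add: graded_ideal_def)

lemma graded_fat_ideal: "graded_ideal (fat_ideal m S)"
  using graded_pair_pow[OF bihomogeneous_xform bihomogeneous_yform]
  by (fastforce simp: graded_ideal_def fat_ideal_eq)

section \<open>Complete intersections are grids\<close>

text \<open>The other inclusion holds for every set of pairs.\<close>

definition grid :: "('a \<times> 'b) set \<Rightarrow> bool" where
  "grid S \<longleftrightarrow> fst ` S \<times> snd ` S \<subseteq> S"

lemma grid_eq: "grid S \<Longrightarrow> S = fst ` S \<times> snd ` S"
  by (force simp: grid_def)

text \<open>A form in x alone does not see the row of a point, so its membership in a point ideal
  depends only on the column.\<close>

lemma bsubst_cong_x:
  "bihomogeneous a 0 F \<Longrightarrow> c X0 = c' X0 \<Longrightarrow> c X1 = c' X1 \<Longrightarrow> bsubst c F = bsubst c' F"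
  unfolding bsubst_def by (rule sum.cong) (auto simp: bihomogeneous_def)

lemma bsubst_cong_y:
  "bihomogeneous 0 b G \<Longrightarrow> c Y0 = c' Y0 \<Longrightarrow> c Y1 = c' Y1 \<Longrightarrow> bsubst c G = bsubst c' G"
  unfolding bsubst_def by (rule sum.cong) (auto simp: bihomogeneous_def)

lemma grid_imp_complete_intersection:
  assumes "grid S" "finite S" "normal_set S"
  shows "complete_intersection S"
proof -
  let ?A = "fst ` S" and ?B = "snd ` S"
  have "points_ideal S = fat_ideal (Suc 0) (?A \<times> ?B)"
    using grid_eq[OF assms(1)] by (simp add: points_ideal_eq)
  also have "\<dots> = ideal_gen {\<Prod>p\<in>?A. xform p, \<Prod>q\<in>?B. yform q}"
    using assms(2,3) by (subst fat_ideal_grid) (auto simp: pair_pow_one normal_set_def simp del: pair_pow.simps)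
  finally have "points_ideal S = ideal_gen {\<Prod>p\<in>?A. xform p, \<Prod>q\<in>?B. yform q}" .
  moreover have "bihomogeneous (card ?A) 0 (\<Prod>p\<in>?A. xform p)"
    using bihomogeneous_xform_prod[where A = ?A and e = "\<lambda>_. 1"] by simp
  ultimately show ?thesis
    using bihomogeneous_yform_prod unfolding complete_intersection_def by blast
qed

text \<open>\<open>F\<close> vanishes along whole columns and \<open>G\<close> along whole rows, so
  both vanish where the column of \<open>P\<close> meets the row of \<open>Q\<close>. A form in the
  ideal of the points that misses an absent corner is then a contradiction.\<close>

lemma complete_intersection_imp_grid:
  assumes S: "finite S" "normal_set S" and "complete_intersection S"
  shows "grid S"
  unfolding grid_def
proof (rule subsetI, rule ccontr)
  fix R assume "R \<in> fst ` S \<times> snd ` S" "R \<notin> S"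
  then obtain P Q where P: "P \<in> S" and Q: "Q \<in> S" and not: "(fst P, snd Q) \<notin> S" by auto
  obtain a b F G where F: "bihomogeneous a 0 F" and G: "bihomogeneous 0 b G"
    and eq: "points_ideal S = ideal_gen {F, G}"
    using assms(3) by (auto simp: complete_intersection_def)
  let ?J = "coord_ideal (Pt (fst P)) (Pt (snd Q))"
  have ok: "normal (fst R)" "normal (snd R)" if "R \<in> S" for R using that S by (auto simp: normal_set_def)
  have mem: "f \<in> coord_ideal (Pt (fst R)) (Pt (snd R))" if "f \<in> {F, G}" "R \<in> S" for f R
  proof -
    have "f \<in> points_ideal S" using that ideal_gen_superset[of "{F, G}"] eq by blast
    then show ?thesis using that by (auto simp: points_ideal_def point_ideal_eq)
  qed
  have "F \<in> ?J"
    using mem[of F P] P Q ok bsubst_cong_x[OF F, of "coord_map (Pt (fst P)) (Pt (snd P))" "coord_map (Pt (fst P)) (Pt (snd Q))"]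
    by (simp add: coord_ideal_iff)
  moreover have "G \<in> ?J"
    using mem[of G Q] P Q ok bsubst_cong_y[OF G, of "coord_map (Pt (fst Q)) (Pt (snd Q))" "coord_map (Pt (fst P)) (Pt (snd Q))"]
    by (simp add: coord_ideal_iff)
  ultimately have sub: "points_ideal S \<subseteq> ?J"
    unfolding eq by (intro ideal_gen_least is_ideal_coord_ideal) auto
  \<comment> \<open>A form through \<open>R\<close> that misses the corner: the column form if the
    columns differ, otherwise the row form, whose row is not that of \<open>Q\<close> because the
    corner is not in \<open>S\<close>.\<close>
  define h where "h R = (if fst R \<noteq> fst P then xform (fst R) else yform (snd R))" for R
  have "(\<Prod>R\<in>S. h R) \<in> points_ideal S"
    unfolding points_ideal_def
  proof
    fix R assume R: "R \<in> S"
    have "h R \<in> point_ideal R"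
      using ok[OF R] ok[OF P] by (simp add: h_def point_ideal_eq xform_mem_coord_ideal yform_mem_coord_ideal)
    then show "(\<Prod>R\<in>S. h R) \<in> point_ideal R"
      using R S(1) by (intro ideal_prod_mem[of _ S R]) (auto simp: point_ideal_eq is_ideal_coord_ideal)
  qed
  moreover have "prime_ideal ?J" using ok P Q by (intro prime_coord_ideal) auto
  ultimately obtain R where R: "R \<in> S" "h R \<in> ?J"
    using prime_ideal_prod[OF _ S(1)] sub by blast
  show False
  proof (cases "fst R = fst P")
    case True
    then have "snd R = snd Q" using R ok P Q by (simp add: h_def yform_mem_coord_ideal)
    then have "R = (fst P, snd Q)" using True by (simp add: prod_eq_iff)
    then show False using R(1) not by simp
  next
    case False
    then show False using R ok P Q by (simp add: h_def xform_mem_coord_ideal)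
  qed
qed

section \<open>Fat points off a grid\<close>

text \<open>Modulo \<open>xform c\<close>, the variable \<open>X1\<close> is a scalar multiple of
  each \<open>xform p\<close> with \<open>p\<close> different from \<open>c\<close>. A product of
  x-forms can thus be traded for a power of \<open>X1\<close>, and only its degree matters.\<close>

lemma xform_prod_kill_imp_X1_power_kill:
  assumes J: "is_ideal J" and c: "normal c" "xform c \<in> J"
    and "finite A" "\<And>p. p \<in> A \<Longrightarrow> normal p \<and> p \<noteq> c" "(\<Prod>p\<in>A. xform p ^ e p) * g \<in> J"
  shows "Var X1 ^ (\<Sum>p\<in>A. e p) * g \<in> J"
proof -
  have pow: "Var X1 ^ n * g \<in> J" if "normal p" "p \<noteq> c" "xform p ^ n * g \<in> J" for p n g
    using that(3)
  proof (induction n arbitrary: g)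
    case (Suc n)
    then have "xform p * (xform p ^ n * g) \<in> J" by (simp add: mult.assoc)
    then have "Var X1 * (xform p ^ n * g) \<in> J"
      using two_forms_kill_variables(2)[OF J that(1) c(1) that(2)] ideal_mult_right[OF J c(2)] by blast
    then have "xform p ^ n * (Var X1 * g) \<in> J" by (simp add: ac_simps)
    from Suc.IH[OF this] show ?case by (simp add: ac_simps)
  qed simp
  show ?thesis using assms(4-)
  proof (induction A arbitrary: g rule: finite_induct)
    case (insert p A)
    then have "xform p ^ e p * ((\<Prod>p\<in>A. xform p ^ e p) * g) \<in> J" by (simp add: mult.assoc)
    then have "Var X1 ^ e p * ((\<Prod>p\<in>A. xform p ^ e p) * g) \<in> J" using pow insert.prems(1)[of p] by blast
    then have "(\<Prod>p\<in>A. xform p ^ e p) * (Var X1 ^ e p * g) \<in> J" by (simp add: ac_simps)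
    then have "Var X1 ^ (\<Sum>p\<in>A. e p) * (Var X1 ^ e p * g) \<in> J" using insert by blast
    then show ?case using insert.hyps by (simp add: power_add ac_simps)
  qed simp
qed

section \<open>Orders of vanishing along the columns\<close>

definition full_rows :: "('a \<times> 'b) set \<Rightarrow> 'b set" where
  "full_rows S = {q \<in> snd ` S. \<forall>p\<in>fst ` S. (p, q) \<in> S}"

text \<open>Division by the full rows costs one order at the points on them and none elsewhere, so
  one point off the full rows keeps the order of its column at \<open>m\<close>. The number
  \<open>w\<close> of the overview counts the columns of the first case.\<close>

definition column_order :: "nat \<Rightarrow> ('a \<times> 'b) set \<Rightarrow> 'a \<Rightarrow> nat" where
  "column_order m S p = (if \<forall>q. (p, q) \<in> S \<longrightarrow> q \<in> full_rows S then m - 1 else m)"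

text \<open>A form of this bidegree in the ideal is divisible by the equation of every full row, for lack
  of degree in \<open>x\<close>; the cofactor depends on \<open>x\<close> only and must vanish to the order \<open>column_order\<close>
  on every column.\<close>
lemma fat_ideal_small_degree_zero:
  fixes S :: "'k::field point set"
  assumes S: "finite S" "normal_set S" and f: "f \<in> fat_ideal m S" and m: "m > 0"
    and hom: "bihomogeneous i (card (full_rows S)) f" and i: "i < (\<Sum>p\<in>fst ` S. column_order m S p)"
  shows "f = 0"
proof -
  let ?A = "fst ` S" and ?full = "full_rows S" and ?e = "column_order m S"
  let ?K = "\<Prod>q\<in>?full. yform q"
  have fin: "finite ?A" "finite ?full" using S by (auto simp: full_rows_def)
  have nA: "normal p" if "p \<in> ?A" for p using that S by (auto simp: normal_set_def)
  have nB: "normal q" if "q \<in> snd ` S" for q using that S by (auto simp: normal_set_def)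
  have nf: "normal q" if "q \<in> ?full" for q using that nB by (auto simp: full_rows_def)
  have base: "adjoin {0} (yform q) = coord_ideal Free (Pt q)" "adjoin {0} (xform p) = coord_ideal (Pt p) Free"
    "adjoin (coord_ideal Free (Pt q)) (xform p) = coord_ideal (Pt p) (Pt q)" for p q :: "'k \<times> 'k"
    unfolding coord_ideal_Free[symmetric] adjoin_coord_ideal by auto
  have pp: "f \<in> pair_pow {0} (yform q) (xform p) m" if "(p, q) \<in> S" for p q
    using f that pair_pow_commute[of "yform q" "xform p" m] by (auto simp: fat_ideal_eq)
  have comp_f: "component i (card ?full) f = f" using component_bihomogeneous[OF hom] by simp
  have "?e p \<le> m" for p by (simp add: column_order_def)
  then have "(\<Sum>p\<in>?A. ?e p) \<le> (\<Sum>p\<in>?A. m)" by (intro sum_mono)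
  then have im: "i < (\<Sum>p\<in>?A. m)" using i by linarith
  \<comment> \<open>Modulo the equation of a full row, \<open>f\<close> is a multiple of the m-th
    powers of all column forms. Their total degree exceeds \<open>i\<close>, so in the bidegree of
    \<open>f\<close> only a multiple of \<open>yform q\<close> is left.\<close>
  have "f \<in> adjoin {0} (yform q ^ 1)" if q: "q \<in> ?full" for q
  proof -
    have "f \<in> adjoin (coord_ideal Free (Pt q)) (\<Prod>p\<in>?A. xform p ^ m)"
    proof (rule adjoin_prod_power[OF is_ideal_coord_ideal fin(1)])
      show "nzd (coord_ideal Free (Pt q)) (xform p)" if "p \<in> ?A" for p
        using nA[OF that] nf[OF q] by (intro nzd_xform) auto
      show "nzd (adjoin (coord_ideal Free (Pt q)) (xform p')) (xform p)" if "p \<in> ?A" "p' \<in> ?A" "p \<noteq> p'" for p p'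
        unfolding base using nA[OF that(1)] nA[OF that(2)] nf[OF q] that(3) by (intro nzd_xform) auto
      show "f \<in> adjoin (coord_ideal Free (Pt q)) (xform p ^ m)" if "p \<in> ?A" for p
        using pp[of p q] q that pair_pow_subset[OF is_ideal_zero, of "yform q" "xform p" m]
        by (auto simp: full_rows_def base)
    qed
    then obtain s r where "f = yform q * s + (\<Prod>p\<in>?A. xform p ^ m) * r"
      unfolding base(1)[symmetric] by (auto elim!: adjoinE)
    then have "f = component i (card ?full) (yform q * s) + component i (card ?full) ((\<Prod>p\<in>?A. xform p ^ m) * r)"
      using comp_f component_add by metis
    moreover have "component i (card ?full) ((\<Prod>p\<in>?A. xform p ^ m) * r) = 0"
      using im by (subst component_mult[OF bihomogeneous_xform_prod]) auto
    moreover obtain s' where "component i (card ?full) (yform q * s) = yform q * s'"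
      using component_mult_eq_mult[OF bihomogeneous_yform] by blast
    ultimately show ?thesis using adjoin_mem[OF is_ideal_zero] by simp
  qed
  then have "f \<in> adjoin {0} (\<Prod>q\<in>?full. yform q ^ 1)"
  proof (rule adjoin_prod_power[OF is_ideal_zero fin(2), rotated -1])
    show "nzd {0} (yform q)" if "q \<in> ?full" for q
      unfolding coord_ideal_Free[symmetric] using nf[OF that] by (intro nzd_yform) auto
    show "nzd (adjoin {0} (yform q')) (yform q)" if "q \<in> ?full" "q' \<in> ?full" "q \<noteq> q'" for q q'
      unfolding base using nf[OF that(1)] nf[OF that(2)] that(3) by (intro nzd_yform) auto
  qed
  then have "\<exists>g0. f = ?K * g0" by (auto simp: adjoin_def)
  then obtain g0 where "f = ?K * g0" ..
  \<comment> \<open>The full rows use up the whole y-degree of \<open>f\<close>, so the cofactor can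
    be taken of bidegree (i, 0).\<close>
  define g where "g = component i 0 g0"
  have fg: "f = ?K * g"
  proof -
    have "component i (card ?full) (?K * g0) = ?K * g"
      by (subst component_mult[OF bihomogeneous_yform_prod]) (simp add: g_def)
    then show ?thesis using comp_f \<open>f = ?K * g0\<close> by metis
  qed
  have comp_g: "component i 0 g = g"
    using component_bihomogeneous[OF bihomogeneous_component, of i 0 i 0 g0] by (simp add: g_def)
  \<comment> \<open>Row forms that miss the point (p, q) cancel modulo every power of its
    ideal.\<close>
  have nzdK: "nzd (pair_pow {0} (yform q) (xform p) n) (\<Prod>q\<in>B. yform q)"
    if "(p, q) \<in> S" "B \<subseteq> ?full" "q \<notin> B" for p q n B
  proof (rule nzd_pair_pow[OF is_ideal_zero])
    have pq: "normal p" "normal q" using that(1) S by (auto simp: normal_set_def)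
    show "nzd {0} (yform q)" "nzd (adjoin {0} (yform q)) (xform p)"
      unfolding coord_ideal_Free[symmetric] adjoin_coord_ideal using pq by (auto intro!: nzd_xform nzd_yform)
    show "nzd (adjoin (adjoin {0} (yform q)) (xform p)) (\<Prod>q\<in>B. yform q)"
      unfolding base
    proof (intro nzd_prod nzd_yform)
      fix q' assume "q' \<in> B"
      then show "normal q'" "case Pt q of Free \<Rightarrow> True | Pt q \<Rightarrow> q' \<noteq> q | Origin \<Rightarrow> False"
        using that nf[of q'] by auto
    qed (use pq in auto)
  qed
  have "g \<in> adjoin {0} (xform p ^ ?e p)" if p: "p \<in> ?A" for p
  proof -
    have "\<exists>q. g \<in> pair_pow {0} (yform q) (xform p) (?e p)"
    proof (cases "\<forall>q. (p, q) \<in> S \<longrightarrow> q \<in> ?full")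
      case True
      \<comment> \<open>Here \<open>yform q\<close> is itself a factor of \<open>?K\<close>; its
        cancellation by \<open>pair_pow_cancel\<close> is what costs one order.\<close>
      obtain q where q: "(p, q) \<in> S" using p by auto
      then have "q \<in> ?full" using True by blast
      then have K: "?K * g = (\<Prod>q\<in>?full-{q}. yform q) * (yform q * g)"
        using fin(2) by (simp add: prod.remove ac_simps)
      have m': "Suc (m - 1) = m" using m by simp
      have "(\<Prod>q\<in>?full-{q}. yform q) * (yform q * g) \<in> pair_pow {0} (yform q) (xform p) (Suc (m - 1))"
        using pp[OF q] unfolding fg K m' .
      then have "yform q * g \<in> pair_pow {0} (yform q) (xform p) (Suc (m - 1))"
        by (rule nzdD[OF nzdK[OF q], rotated -1]) auto
      then have "g \<in> pair_pow {0} (yform q) (xform p) (m - 1)"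
      proof (rule pair_pow_cancel[OF is_ideal_zero, rotated -1])
        have pq: "normal p" "normal q" using q S by (auto simp: normal_set_def)
        show "nzd {0} (yform q)" "nzd (adjoin {0} (yform q)) (xform p)"
          unfolding coord_ideal_Free[symmetric] adjoin_coord_ideal using pq by (auto intro!: nzd_xform nzd_yform)
      qed
      moreover have "?e p = m - 1" unfolding column_order_def by (rule if_P[OF True])
      ultimately show ?thesis by metis
    next
      case False
      then obtain q where q: "(p, q) \<in> S" "q \<notin> ?full" by blast
      have "?K * g \<in> pair_pow {0} (yform q) (xform p) m" using pp[OF q(1)] fg by simp
      then have "g \<in> pair_pow {0} (yform q) (xform p) m" using nzdD[OF nzdK[OF q(1) _ q(2)]] by blast
      moreover have "?e p = m" unfolding column_order_def by (rule if_not_P[OF False])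
      ultimately show ?thesis by metis
    qed
    then obtain q where "g \<in> adjoin (adjoin {0} (yform q)) (xform p ^ ?e p)"
      using pair_pow_subset[OF is_ideal_zero] by blast
    then obtain s r where "g = yform q * s + xform p ^ ?e p * r" by (auto elim!: adjoinE)
    then have "g = component i 0 (yform q * s) + component i 0 (xform p ^ ?e p * r)"
      using comp_g component_add by metis
    \<comment> \<open>Multiples of \<open>yform q\<close> have nothing in y-degree 0, so
      \<open>g\<close> is divisible by the power of the column form outright.\<close>
    moreover have "component i 0 (yform q * s) = 0"
      by (subst component_mult[OF bihomogeneous_yform]) auto
    moreover obtain r' where "component i 0 (xform p ^ ?e p * r) = xform p ^ ?e p * r'"
      using component_mult_eq_mult[OF bihomogeneous_xform_power] by blast
    ultimately show ?thesis using adjoin_mem[OF is_ideal_zero] by simp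
  qed
  then have "g \<in> adjoin {0} (\<Prod>p\<in>?A. xform p ^ ?e p)"
  proof (rule adjoin_prod_power[OF is_ideal_zero fin(1), rotated -1])
    show "nzd {0} (xform p)" if "p \<in> ?A" for p
      unfolding coord_ideal_Free[symmetric] using nA[OF that] by (intro nzd_xform) auto
    show "nzd (adjoin {0} (xform p')) (xform p)" if "p \<in> ?A" "p' \<in> ?A" "p \<noteq> p'" for p p'
      unfolding base using nA[OF that(1)] nA[OF that(2)] that(3) by (intro nzd_xform) auto
  qed
  then have "\<exists>r. g = (\<Prod>p\<in>?A. xform p ^ ?e p) * r" by (auto simp: adjoin_def)
  then obtain r where "g = (\<Prod>p\<in>?A. xform p ^ ?e p) * r" ..
  then have "g = 0"
    using comp_g i component_mult[OF bihomogeneous_xform_prod, of i 0 ?e ?A r] by simp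
  then show ?thesis using fg by simp
qed

text \<open>Off a grid some point lies in a row that is not full, and its column keeps the order
  \<open>m\<close>. For the second bound, the columns through row \<open>q\<close> all keep the
  order \<open>m\<close>, while a column that misses the row adds at least \<open>m - 1\<close>,
  which is positive as \<open>m >= 2\<close>.\<close>

lemma not_grid_column_order:
  assumes fin: "finite S" and m: "m \<ge> 2" and "\<not> grid S"
  shows "(\<Sum>p\<in>fst ` S. m - 1) < (\<Sum>p\<in>fst ` S. column_order m S p)"
    and "\<And>q. q \<in> snd ` S - full_rows S \<Longrightarrow> (\<Sum>p\<in>{p. (p, q) \<in> S}. m) < (\<Sum>p\<in>fst ` S. column_order m S p)"
proof -
  let ?A = "fst ` S" and ?e = "column_order m S"
  obtain P Q where PQ: "P \<in> S" "Q \<in> S" "(fst P, snd Q) \<notin> S"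
    using assms(3) by (auto simp: grid_def)
  then have "snd Q \<notin> full_rows S" by (auto simp: full_rows_def)
  then have "?e (fst Q) = m" using PQ by (auto simp: column_order_def)
  moreover have ge: "m - 1 \<le> ?e p" for p by (simp add: column_order_def)
  ultimately show "(\<Sum>p\<in>?A. m - 1) < (\<Sum>p\<in>?A. ?e p)"
    using fin m PQ(2) by (intro sum_strict_mono_ex1) (auto intro!: bexI[of _ Q])
  fix q assume q: "q \<in> snd ` S - full_rows S"
  let ?C = "{p. (p, q) \<in> S}"
  have CA: "?C \<subseteq> ?A" by force
  obtain p where p: "p \<in> ?A - ?C" using q by (auto simp: full_rows_def)
  have "(\<Sum>p\<in>?A. ?e p) = (\<Sum>p\<in>?C. ?e p) + (\<Sum>p\<in>?A - ?C. ?e p)"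
    using CA fin by (simp add: sum.subset_diff add.commute)
  moreover have "(\<Sum>p\<in>?C. ?e p) = (\<Sum>p\<in>?C. m)"
    using q by (intro sum.cong) (auto simp: column_order_def)
  moreover have "?e p \<le> (\<Sum>p\<in>?A - ?C. ?e p)"
    using p fin by (intro member_le_sum) auto
  ultimately show "(\<Sum>p\<in>?C. m) < (\<Sum>p\<in>?A. ?e p)" using ge[of p] m by linarith
qed

lemma pair_pow_mult_mem:
  assumes "is_ideal J" "k + l = n" shows "u ^ k * v ^ l * h \<in> pair_pow J u v n"
  using assms(2)
proof (induction k arbitrary: n)
  case 0 then show ?case using pair_pow_right[OF assms(1)] by simp
next
  case (Suc k)
  then show ?case using pair_pow_left[OF assms(1) Suc.IH[of "n - 1"]] by (cases n) (auto simp: mult.assoc)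
qed

text \<open>Orders of vanishing add up; a form that is absent from the product counts with exponent
  0.\<close>

lemma forms_prod_mem_fat_ideal:
  assumes fin: "finite A" "finite B" and "\<And>p q. (p, q) \<in> S \<Longrightarrow>
      (if p \<in> A then a p else 0) + (if q \<in> B then b q else 0) \<ge> m"
  shows "(\<Prod>p\<in>A. xform p ^ a p) * (\<Prod>q\<in>B. yform q ^ b q) \<in> fat_ideal m S"
  unfolding fat_ideal_eq
proof clarify
  fix p q assume pq: "(p, q) \<in> S"
  define k l where "k = (if p \<in> A then a p else 0)" and "l = (if q \<in> B then b q else 0)"
  have "\<exists>h. (\<Prod>p\<in>A. xform p ^ a p) = xform p ^ k * h"
    using fin(1) by (cases "p \<in> A") (auto simp: k_def prod.remove)
  moreover have "\<exists>h. (\<Prod>q\<in>B. yform q ^ b q) = yform q ^ l * h"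
    using fin(2) by (cases "q \<in> B") (auto simp: l_def prod.remove)
  ultimately obtain h h' where hh: "(\<Prod>p\<in>A. xform p ^ a p) = xform p ^ k * h"
    "(\<Prod>q\<in>B. yform q ^ b q) = yform q ^ l * h'" by blast
  have "k + l \<ge> m" using assms(3)[OF pq] by (simp add: k_def l_def)
  \<comment> \<open>Truncation, since \<open>pair_pow_mult_mem\<close> wants exponents with sum
    exactly \<open>m\<close>.\<close>
  moreover define k' l' where "k' = min k m" and "l' = m - k'"
  ultimately have kl: "k' \<le> k" "l' \<le> l" "k' + l' = m" by auto
  then have "xform p ^ k = xform p ^ k' * xform p ^ (k - k')" "yform q ^ l = yform q ^ l' * yform q ^ (l - l')"
    by (simp_all flip: power_add)
  then have "(\<Prod>p\<in>A. xform p ^ a p) * (\<Prod>q\<in>B. yform q ^ b q) =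
      xform p ^ k' * yform q ^ l' * (xform p ^ (k - k') * yform q ^ (l - l') * h * h')"
    unfolding hh by (simp only: ac_simps)
  then show "(\<Prod>p\<in>A. xform p ^ a p) * (\<Prod>q\<in>B. yform q ^ b q)
      \<in> pair_pow {0} (xform (fst (p, q))) (yform (snd (p, q))) m"
    using pair_pow_mult_mem[OF is_ideal_zero kl(3)] by simp
qed

text \<open>The witness \<open>z\<close> is \<open>x\<^sub>1\<^sup>i\<close> times the equations of the full rows, with \<open>i\<close> one less than the sum of
  the column orders. It is not in \<open>I + (l)\<close> for a general linear form \<open>l\<close> in \<open>x\<close>, but products of
  forms in \<open>y\<close> without common zero multiply it into that ideal, so a multiple of \<open>z\<close> is a socle
  element.\<close>
lemma depth_fat_ideal_not_grid:
  fixes S :: "'k::alg_closed_field point set"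
  assumes S: "finite S" "normal_set S" and m: "m \<ge> 2" and "\<not> grid S"
  shows "depth_quot (fat_ideal m S) \<le> 1"
proof -
  let ?A = "fst ` S" and ?B = "snd ` S" and ?full = "full_rows S" and ?I = "fat_ideal m S"
  let ?K = "\<Prod>q\<in>?full. yform q"
  have fin: "finite ?A" "finite ?B" "finite ?full" using S by (auto simp: full_rows_def)
  have nA: "normal p" if "p \<in> ?A" for p using that S by (auto simp: normal_set_def)
  have nB: "normal q" if "q \<in> ?B" for q using that S by (auto simp: normal_set_def)
  have AB: "p \<in> ?A" "q \<in> ?B" if "(p, q) \<in> S" for p q using that by force+
  have fullB: "?full \<subseteq> ?B" by (auto simp: full_rows_def)
  note order = not_grid_column_order[OF S(1) m \<open>\<not> grid S\<close>]
  \<comment> \<open>The second coordinate 1 keeps \<open>c\<close> away from (1, 0), so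
    \<open>X1\<close>, from which the witness is built, does not vanish modulo
    \<open>xform c\<close>.\<close>
  obtain c' where "(c', 1) \<notin> ?A" using ex_normal_avoiding[OF fin(1)] ..
  then obtain c where c: "normal c" "c \<notin> ?A" "c \<noteq> (1, 0)" by (auto simp: normal_def)
  define J where "J = adjoin ?I (xform c)"
  note I = is_ideal_fat_ideal[of m S]
  have J: "is_ideal J" unfolding J_def by (rule is_ideal_adjoin[OF I])
  have IJ: "?I \<subseteq> J" unfolding J_def by (rule adjoin_superset)
  have cJ: "xform c \<in> J" unfolding J_def by (rule adjoin_self[OF I])
  define i where "i = (\<Sum>p\<in>?A. column_order m S p) - 1"
  have i: "i < (\<Sum>p\<in>?A. column_order m S p)" using order(1) by (simp add: i_def)
  define z where "z = Var X1 ^ i * ?K"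
  have X1: "Var X1 = - xform (1, 0)" by (simp add: lform_def Const_zero Const_one)
  have hX1: "bihomogeneous i 0 (Var X1 ^ i)"
    using bihomogeneous_power[OF bihomogeneous_Const_Var, of i X1 1] by (simp add: Const_one)
  have hz: "bihomogeneous i (card ?full) z"
    unfolding z_def using bihomogeneous_mult[OF hX1 bihomogeneous_yform_prod] by simp
  \<comment> \<open>In the bidegree of \<open>z\<close> the fat ideal is zero, so \<open>z\<close>
    would be a multiple of \<open>xform c\<close>, a prime form that divides neither
    \<open>X1\<close> nor any row form.\<close>
  have "z \<notin> J"
  proof
    assume "z \<in> J"
    then obtain f h where fh: "f \<in> ?I" "z = f + xform c * h" unfolding J_def by (rule adjoinE)
    let ?f = "component i (card ?full) f"
    obtain h' where h': "component i (card ?full) (xform c * h) = xform c * h'"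
      using component_mult_eq_mult[OF bihomogeneous_xform] by blast
    have "z = component i (card ?full) z" using component_bihomogeneous[OF hz] by simp
    also have "\<dots> = ?f + xform c * h'" by (simp only: fh component_add h')
    finally have z: "z = ?f + xform c * h'" .
    have "?f \<in> ?I" using fh(1) graded_fat_ideal[of m S] unfolding graded_ideal_def by blast
    then have "?f = 0"
      using m by (intro fat_ideal_small_degree_zero[OF S _ _ bihomogeneous_component i]) auto
    then have "z \<in> adjoin (coord_ideal Free Free) (xform c)"
      using z adjoin_mem[OF is_ideal_coord_ideal, of "xform c" h' Free Free] by simp
    then have "z \<in> coord_ideal (Pt c) Free" by (simp add: adjoin_coord_ideal)
    moreover have prime: "prime_ideal (coord_ideal (Pt c) Free)" using c by (intro prime_coord_ideal) auto
    ultimately consider "Var X1 ^ i \<in> coord_ideal (Pt c) Free" | "?K \<in> coord_ideal (Pt c) Free"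
      by (auto simp: z_def prime_ideal_def)
    then show False
    proof cases
      case 1
      then have "Var X1 \<in> coord_ideal (Pt c) Free" by (rule prime_ideal_power[OF prime])
      then have "xform (1, 0) \<in> coord_ideal (Pt c) Free"
        using ideal_uminus[OF is_ideal_coord_ideal] by (fastforce simp: X1)
      then show False using c by (subst (asm) xform_mem_coord_ideal) (auto simp: normal_def)
    next
      case 2
      then obtain q where "q \<in> ?full" "yform q \<in> coord_ideal (Pt c) Free"
        using prime_ideal_prod[OF prime fin(3)] by blast
      then show False using c nB[of q] fullB by (subst (asm) yform_mem_coord_ideal) auto
    qed
  qed
  \<comment> \<open>The x-forms are traded for a power of \<open>X1\<close>, and the spare degree up
    to \<open>i\<close> is filled with further factors \<open>X1\<close>.\<close>
  have raise: "g * z \<in> J" if "finite C" "C \<subseteq> ?A" "(\<Sum>p\<in>C. a p) \<le> i"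
      "(\<Prod>p\<in>C. xform p ^ a p) * (g * ?K) \<in> J" for C a g
  proof -
    have "normal p \<and> p \<noteq> c" if "p \<in> C" for p using that \<open>C \<subseteq> ?A\<close> c nA by blast
    then have "Var X1 ^ (\<Sum>p\<in>C. a p) * (g * ?K) \<in> J"
      using xform_prod_kill_imp_X1_power_kill[OF J c(1) cJ that(1) _ that(4)] by blast
    then have "Var X1 ^ (i - (\<Sum>p\<in>C. a p)) * (Var X1 ^ (\<Sum>p\<in>C. a p) * (g * ?K)) \<in> J"
      by (rule ideal_mult[OF J])
    then have "Var X1 ^ i * (g * ?K) \<in> J"
      using that(3) by (simp flip: mult.assoc power_add)
    then show ?thesis by (simp add: z_def ac_simps)
  qed
  \<comment> \<open>Exponents \<open>m - 1\<close> on all columns, 1 on full rows and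
    \<open>m\<close> on other rows reach \<open>m\<close> at every point; the factor
    \<open>?K\<close> of \<open>z\<close> supplies the full rows.\<close>
  have kill_rows: "(\<Prod>q\<in>?B - ?full. yform q ^ m) * z \<in> J"
  proof (rule raise[OF fin(1) order_refl])
    show "(\<Sum>p\<in>?A. m - 1) \<le> i" using order(1) by (simp add: i_def)
    have "(\<Prod>q\<in>?B - ?full. yform q ^ m) = (\<Prod>q\<in>?B - ?full. yform q ^ (if q \<in> ?full then 1 else m))"
      "?K = (\<Prod>q\<in>?full. yform q ^ (if q \<in> ?full then 1 else m))"
      by (intro prod.cong; simp)+
    then have "(\<Prod>q\<in>?B - ?full. yform q ^ m) * ?K = (\<Prod>q\<in>?B. yform q ^ (if q \<in> ?full then 1 else m))"
      using prod.subset_diff[OF fullB fin(2), of "\<lambda>q. yform q ^ (if q \<in> ?full then 1 else m)"]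
      by (simp only:)
    moreover have "(\<Prod>p\<in>?A. xform p ^ (m - 1)) * (\<Prod>q\<in>?B. yform q ^ (if q \<in> ?full then 1 else m)) \<in> ?I"
      using m AB by (intro forms_prod_mem_fat_ideal fin) (simp, linarith)
    ultimately show "(\<Prod>p\<in>?A. xform p ^ (m - 1)) * ((\<Prod>q\<in>?B - ?full. yform q ^ m) * ?K) \<in> J"
      using IJ by auto
  qed
  \<comment> \<open>The columns through row \<open>Q\<close> take care of its points and the
    remaining rows of all others. Omitting \<open>Q\<close> is what later yields a second, different
    row form.\<close>
  have kill_row: "(\<Prod>q\<in>?B - {Q}. yform q ^ m) * z \<in> J" if Q: "Q \<in> ?B - ?full" for Q
  proof (rule raise)
    show C: "{p. (p, Q) \<in> S} \<subseteq> ?A" by force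
    then show fC: "finite {p. (p, Q) \<in> S}" using fin(1) finite_subset by blast
    show "(\<Sum>p\<in>{p. (p, Q) \<in> S}. m) \<le> i" using order(2)[OF Q] by (simp add: i_def)
    have "(\<Prod>p\<in>{p. (p, Q) \<in> S}. xform p ^ m) * (\<Prod>q\<in>?B - {Q}. yform q ^ m) \<in> ?I"
      using fin fC AB by (intro forms_prod_mem_fat_ideal) auto
    then have "(\<Prod>p\<in>{p. (p, Q) \<in> S}. xform p ^ m) * (\<Prod>q\<in>?B - {Q}. yform q ^ m) * ?K \<in> J"
      by (rule ideal_mult_right[OF J subsetD[OF IJ]])
    then show "(\<Prod>p\<in>{p. (p, Q) \<in> S}. xform p ^ m) * ((\<Prod>q\<in>?B - {Q}. yform q ^ m) * ?K) \<in> J"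
      by (simp only: mult.assoc)
  qed
  have kill_x: "(\<Prod>p\<in>?A. xform p ^ m) \<in> J"
    using forms_prod_mem_fat_ideal[OF fin(1) finite.emptyI, of S m "\<lambda>_. m" "\<lambda>_. 0"] IJ AB by auto
  \<comment> \<open>Three passes give row forms at \<open>Q\<close> and at some other
    \<open>Q'\<close>, and a column form at \<open>p\<close>. Together with \<open>xform c\<close>
    they span all linear forms.\<close>
  obtain Q r where Q: "Q \<in> ?B - ?full" "r * z \<notin> J" "yform Q * (r * z) \<in> J"
    using killed_by_prod_factor[OF J _ kill_rows \<open>z \<notin> J\<close>] fin by blast
  have kill_Q: "(\<Prod>q\<in>?B - {Q}. yform q ^ m) * (r * z) \<in> J"
    using ideal_mult[OF J kill_row[OF Q(1)], of r] by (simp add: ac_simps)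
  obtain Q' s where Q': "Q' \<in> ?B - {Q}" "s * (r * z) \<notin> J" "yform Q' * (s * (r * z)) \<in> J"
    using killed_by_prod_factor[OF J _ kill_Q Q(2)] fin by blast
  obtain p t where p: "p \<in> ?A" "t * (s * (r * z)) \<notin> J" "xform p * (t * (s * (r * z))) \<in> J"
    using killed_by_prod_factor[OF J fin(1) ideal_mult_right[OF J kill_x] Q'(2)] by blast
  define w where "w = t * (s * (r * z))"
  have "yform Q * w \<in> J" using ideal_mult[OF J Q(3), of "t * s"] by (simp add: w_def ac_simps)
  moreover have "yform Q' * w \<in> J" using ideal_mult[OF J Q'(3), of t] by (simp add: w_def ac_simps)
  moreover have "xform p * w \<in> J" using p by (simp add: w_def)
  moreover have "xform c * w \<in> J" by (rule ideal_mult_right[OF J cJ])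
  moreover have "normal Q" "normal Q'" "Q \<noteq> Q'" "normal p" "p \<noteq> c" using Q Q' p c nA nB by auto
  ultimately have "Var v * w \<in> J" for v
    using two_forms_kill_variables[OF J, of Q Q' Y0 Y1 w] two_forms_kill_variables[OF J, of p c X0 X1 w] c(1)
    by (cases v) blast+
  moreover have "w \<notin> J" using p by (simp add: w_def)
  ultimately have "has_socle irrelevant_ideal J" by (intro has_socle_irrelevantI[OF J])
  moreover have "nzd ?I (xform c)" using nzd_fat_ideal_xform[OF S(2) c(1,2)] .
  ultimately show ?thesis using depth_quot_le_one[OF I lform_irrelevant] unfolding J_def by blast
qed

section \<open>Normalising coordinates\<close>

definition normalize_pair :: "'k::field \<times> 'k \<Rightarrow> 'k \<times> 'k" where
  "normalize_pair p = (if snd p = 0 then (1, 0) else (fst p / snd p, 1))"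

lemma normal_normalize_pair: "normal (normalize_pair p)"
  by (simp add: normal_def normalize_pair_def)

lemma lform_normalize_pair:
  assumes "p \<noteq> (0, 0)"
  shows "\<exists>a b. lform u v p = Const a * lform u v (normalize_pair p) \<and>
    lform u v (normalize_pair p) = Const b * lform u v p"
proof (cases "snd p = 0")
  case True
  then have "fst p \<noteq> 0" using assms by (simp add: prod_eq_iff)
  then have "Const (inverse (fst p)) * Const (fst p) = 1" by (simp add: Const_one flip: Const_mult)
  then show ?thesis using True
    by (intro exI[of _ "fst p"] exI[of _ "inverse (fst p)"])
      (simp add: lform_def normalize_pair_def Const_zero Const_one flip: mult.assoc)
next
  case False
  then have *: "Const (inverse (snd p)) * Const (snd p) = 1" "Const (snd p) * Const (fst p / snd p) = Const (fst p)"
     "Const (inverse (snd p)) * Const (fst p) = Const (fst p / snd p)"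
    by (simp_all add: Const_one field_simps flip: Const_mult)
  have "lform u v p = Const (snd p) * lform u v (normalize_pair p)"
    using False * by (simp add: lform_def normalize_pair_def Const_one right_diff_distrib flip: mult.assoc)
  moreover have "lform u v (normalize_pair p) = Const (inverse (snd p)) * lform u v p"
    using False * by (simp add: lform_def normalize_pair_def Const_one right_diff_distrib flip: mult.assoc)
  ultimately show ?thesis by blast
qed

definition normalize_point :: "'k::field point \<Rightarrow> 'k point" where
  "normalize_point P = (normalize_pair (fst P), normalize_pair (snd P))"

lemma point_ideal_normalize:
  assumes "valid_point P" shows "point_ideal (normalize_point P) = point_ideal P"
proof -
  have mem: "f \<in> ideal_gen G" if "f = Const a * g" "g \<in> G" for f g a and G :: "'k::field bpoly set"
    using that ideal_gen_superset ideal_mult[OF is_ideal_ideal_gen] by blast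
  obtain a b c d where e:
    "xform (fst P) = Const a * xform (normalize_pair (fst P))" "xform (normalize_pair (fst P)) = Const b * xform (fst P)"
    "yform (snd P) = Const c * yform (normalize_pair (snd P))" "yform (normalize_pair (snd P)) = Const d * yform (snd P)"
    using lform_normalize_pair assms unfolding valid_point_def by metis
  have "xform (fst P) \<in> ideal_gen {xform (normalize_pair (fst P)), yform (normalize_pair (snd P))}"
    "yform (snd P) \<in> ideal_gen {xform (normalize_pair (fst P)), yform (normalize_pair (snd P))}"
    "xform (normalize_pair (fst P)) \<in> ideal_gen {xform (fst P), yform (snd P)}"
    "yform (normalize_pair (snd P)) \<in> ideal_gen {xform (fst P), yform (snd P)}"
    by (rule mem[OF e(1)], simp) (rule mem[OF e(3)], simp, rule mem[OF e(2)], simp, rule mem[OF e(4)], simp)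
  then have "ideal_gen {xform (normalize_pair (fst P)), yform (normalize_pair (snd P))} =
      ideal_gen {xform (fst P), yform (snd P)}"
    by (intro ideal_gen_eqI) (simp_all only: insert_subset empty_subsetI simp_thms)
  then show ?thesis
    by (simp add: point_ideal_eq coord_ideal_def normalize_point_def insert_commute)
qed

theorem theorem5p4:
  fixes m :: nat and S :: "('k::alg_closed_field) point set"
  assumes "m \<ge> 2" and "finite S" and "S \<noteq> {}" and "\<forall>P\<in>S. valid_point P"
  shows "ACM_ideal (fat_ideal m S) \<longleftrightarrow> complete_intersection S"
proof -
  \<comment> \<open>\<open>S\<close> may hold several representatives of one point; normalising
    merges them without changing either ideal.\<close>
  define T where "T = normalize_point ` S"
  have T: "finite T" "T \<noteq> {}" "normal_set T"
    using assms by (auto simp: T_def normal_set_def normalize_point_def normal_normalize_pair)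
  have "fat_ideal m T = fat_ideal m S" "points_ideal T = points_ideal S"
    using assms(4) by (simp_all add: fat_ideal_def points_ideal_def T_def point_ideal_normalize)
  then have eq: "fat_ideal m S = fat_ideal m T" "complete_intersection S \<longleftrightarrow> complete_intersection T"
    by (simp_all add: complete_intersection_def)
  show ?thesis
  proof (cases "grid T")
    case True
    have "depth_quot (fat_ideal m (fst ` T \<times> snd ` T)) = 2"
      using T assms(1) by (intro depth_fat_ideal_grid) (auto simp: normal_set_def)
    then have "depth_quot (fat_ideal m T) = 2" using grid_eq[OF True] by simp
    moreover have "krull_dim_quot (fat_ideal m T) = 2" using T assms(1) by (intro krull_dim_fat_ideal) auto
    ultimately show ?thesis
      using grid_imp_complete_intersection[OF True T(1,3)] by (simp add: eq ACM_ideal_def)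
  next
    case False
    have "depth_quot (fat_ideal m T) \<le> 1" using depth_fat_ideal_not_grid[OF T(1,3) assms(1) False] .
    also have "(1 :: enat) < 2" by simp
    also have "2 \<le> krull_dim_quot (fat_ideal m T)" using T assms(1) by (intro krull_dim_fat_ideal_ge) auto
    finally have "\<not> ACM_ideal (fat_ideal m S)" by (simp add: eq ACM_ideal_def)
    then show ?thesis using complete_intersection_imp_grid[OF T(1,3)] False eq by blast
  qed
qed

end
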